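(* The comparison functor $K:\mathbf{RBA}\to\mathbf{ALG}^{\mathbf T}$ is an isomorphism of categories, i.e., $\mathbf{RBA}$ is monadic over $\mathbf{ALG}$.
   Context: Fix a commutative ring $\mathbf k$ with identity and $\lambda\in\mathbf k$. All algebras are commutative $\mathbf k$-algebras with identity, algebra homomorphisms preserve the identity, and tensor products are over $\mathbf k$. $\mathbf{ALG}$ is the category of such algebras. A Rota-Baxter operator (of weight $\lambda$) on an algebra $R$ is a $\mathbf k$-linear $P:R\to R$ with $P(x)P(y)=P(xP(y))+P(yP(x))+\lambda P(xy)$ for all $x,y\in R$; $(R,P)$ is then a Rota-Baxter algebra. A homomorphism $(R,P)\to(S,Q)$ is an algebra homomorphism $f$ with $f\circ P=Q\circ f$. $\mathbf{RBA}$ is the resulting category and $U:\mathbf{RBA}\to\mathbf{ALG}$, $U(R,P)=R$, the forgetful functor. For an algebra $A$, $\mathrm{Sha}(A)=\bigoplus_{i\ge1}A^{\otimes i}$ as a module, with product $\diamond$ defined for $\mathfrak a=a_0\otimes\cdots\otimes a_m$, $\mathfrak b=b_0\otimes\cdots\otimes b_n$ by: $\mathfrak a\diamond\mathfrak b=a_0b_0\otimes b_1\otimes\cdots\otimes b_n$ if $m=0$; $\mathfrak a\diamond\mathfrak b=a_0b_0\otimes a_1\otimes\cdots\otimes a_m$ if $n=0$; and, if $m,n>0$, recursively, $\mathfrak a\diamond\mathfrak b=(a_0b_0)\otimes\big((a_1\otimes\cdots\otimes a_m)\diamond(\mathbf 1_A\otimes b_1\otimes\cdots\otimes b_n)+(\mathbf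 1_A\otimes a_1\otimes\cdots\otimes a_m)\diamond(b_1\otimes\cdots\otimes b_n)+\lambda(a_1\otimes\cdots\otimes a_m)\diamond(b_1\otimes\cdots\otimes b_n)\big)$. $P_A(x_0\otimes\cdots\otimes x_n)=\mathbf 1_A\otimes x_0\otimes\cdots\otimes x_n$. It is known that $(\mathrm{Sha}(A),P_A)$ with the inclusion $\eta_A:A\to\mathrm{Sha}(A)$ is the free Rota-Baxter algebra on the algebra $A$, so that $F(A)=(\mathrm{Sha}(A),P_A)$ (with $F(f)=\mathrm{Sha}(f)$ applying $f$ to each tensor factor) is left adjoint to $U$, with unit $\eta$ and counit $\varepsilon_{(A,P)}:(\mathrm{Sha}(A),P_A)\to(A,P)$, $\varepsilon_{(A,P)}(a_0\otimes\cdots\otimes a_n)=a_0P(a_1P(\cdots P(a_n)\cdots))$. This adjunction gives the monad $\mathbf T=\langle T,\eta,\mu\rangle$ on $\mathbf{ALG}$ with $T=UF$, $\mu=U\varepsilon F$. $\mathbf{ALG}^{\mathbf T}$ is the category of $\mathbf T$-algebras: objects are pairs $\langle A,h\rangle$ with $h:\mathrm{Sha}(A)\to A$ an algebra homomorphism such that $h\circ\eta_A=\mathrm{id}_A$ and $h\circ T(h)=h\circ\mu_A$; morphisms $\langle R,f\rangle\to\langle S,g\rangle$ are algebra homomorphisms $\phi:R\to S$ with $g\circ T(\phi)=\phi\circ f$. The comparison functor $K$ is given by $K(R,P)=\langle R,U(\varepsilon_{(R,P)})\rangle$ on objects and is the identity on underlying algebra homomorphisms. *)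

theory Defs
  imports "HOL-Algebra.Module" "HOL-Algebra.AbelCoset" "HOL-Algebra.Product_Groups"
begin

section \<open>Categories and isomorphisms of categories\<close>

text \<open>Hom-sets of distinct pairs of objects need not be disjoint; composition, identities and the
  action of a functor on morphisms therefore take the objects involved as arguments.
  \<open>Cmp C X Y Z g f\<close> is the composite of \<open>f : X \<rightarrow> Y\<close> and \<open>g : Y \<rightarrow> Z\<close>.\<close>

record ('o, 'm) cat =
  Obj :: "'o set"
  Hom :: "'o \<Rightarrow> 'o \<Rightarrow> 'm set"
  Ide :: "'o \<Rightarrow> 'm"
  Cmp :: "'o \<Rightarrow> 'o \<Rightarrow> 'o \<Rightarrow> 'm \<Rightarrow> 'm \<Rightarrow> 'm"

definition is_category :: "('o, 'm) cat \<Rightarrow> bool" where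
  "is_category C \<longleftrightarrow>
    (\<forall>X\<in>Obj C. Ide C X \<in> Hom C X X) \<and>
    (\<forall>X\<in>Obj C. \<forall>Y\<in>Obj C. \<forall>Z\<in>Obj C. \<forall>f\<in>Hom C X Y. \<forall>g\<in>Hom C Y Z.
        Cmp C X Y Z g f \<in> Hom C X Z) \<and>
    (\<forall>X\<in>Obj C. \<forall>Y\<in>Obj C. \<forall>f\<in>Hom C X Y.
        Cmp C X X Y f (Ide C X) = f \<and> Cmp C X Y Y (Ide C Y) f = f) \<and>
    (\<forall>W\<in>Obj C. \<forall>X\<in>Obj C. \<forall>Y\<in>Obj C. \<forall>Z\<in>Obj C.
      \<forall>f\<in>Hom C W X. \<forall>g\<in>Hom C X Y. \<forall>h\<in>Hom C Y Z.
        Cmp C W X Z (Cmp C X Y Z h g) f = Cmp C W Y Z h (Cmp C W X Y g f))"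

record ('o, 'm, 'p, 'n) cat_fun =
  on_obj :: "'o \<Rightarrow> 'p"
  on_hom :: "'o \<Rightarrow> 'o \<Rightarrow> 'm \<Rightarrow> 'n"

definition is_functor :: "('o, 'm) cat \<Rightarrow> ('p, 'n) cat \<Rightarrow> ('o, 'm, 'p, 'n) cat_fun \<Rightarrow> bool" where
  "is_functor C D F \<longleftrightarrow>
    is_category C \<and> is_category D \<and>
    (\<forall>X\<in>Obj C. on_obj F X \<in> Obj D) \<and>
    (\<forall>X\<in>Obj C. \<forall>Y\<in>Obj C. \<forall>f\<in>Hom C X Y.
        on_hom F X Y f \<in> Hom D (on_obj F X) (on_obj F Y)) \<and>
    (\<forall>X\<in>Obj C. on_hom F X X (Ide C X) = Ide D (on_obj F X)) \<and>
    (\<forall>X\<in>Obj C. \<forall>Y\<in>Obj C. \<forall>Z\<in>Obj C. \<forall>f\<in>Hom C X Y. \<forall>g\<in>Hom C Y Z.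
        on_hom F X Z (Cmp C X Y Z g f) =
          Cmp D (on_obj F X) (on_obj F Y) (on_obj F Z) (on_hom F Y Z g) (on_hom F X Y f))"

text \<open>\<open>G \<circ> F\<close> is the identity functor of \<open>C\<close>.\<close>

definition is_left_inverse_functor ::
    "('o, 'm) cat \<Rightarrow> ('o, 'm, 'p, 'n) cat_fun \<Rightarrow> ('p, 'n, 'o, 'm) cat_fun \<Rightarrow> bool" where
  "is_left_inverse_functor C F G \<longleftrightarrow>
    (\<forall>X\<in>Obj C. on_obj G (on_obj F X) = X) \<and>
    (\<forall>X\<in>Obj C. \<forall>Y\<in>Obj C. \<forall>f\<in>Hom C X Y.
        on_hom G (on_obj F X) (on_obj F Y) (on_hom F X Y f) = f)"

definition is_cat_isomorphism ::
    "('o, 'm) cat \<Rightarrow> ('p, 'n) cat \<Rightarrow> ('o, 'm, 'p, 'n) cat_fun \<Rightarrow> bool" where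
  "is_cat_isomorphism C D F \<longleftrightarrow>
    is_functor C D F \<and>
    (\<exists>G. is_functor D C G \<and> is_left_inverse_functor C F G \<and> is_left_inverse_functor D G F)"


section \<open>Direct sums, free modules, quotients and tensor powers\<close>

text \<open>The fields \<open>mult\<close> and \<open>one\<close> of the record type \<open>module\<close> play no role for a mere module and
  are left undefined. A commutative \<open>k\<close>-algebra with identity is a record \<open>A\<close> with
  \<open>algebra k A\<close>, as in \<open>HOL-Algebra\<close>.\<close>

definition direct_sum :: "'i set \<Rightarrow> ('i \<Rightarrow> ('k, 'b) module) \<Rightarrow> ('k, 'i \<Rightarrow> 'b) module" where
  "direct_sum I M =
    \<lparr>carrier = carrier (sum_group I (\<lambda>i. add_monoid (M i))),
     mult = undefined, one = undefined,
     zero = \<one>\<^bsub>sum_group I (\<lambda>i. add_monoid (M i))\<^esub>,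
     add = (\<lambda>u v. u \<otimes>\<^bsub>sum_group I (\<lambda>i. add_monoid (M i))\<^esub> v),
     smult = (\<lambda>c u. \<lambda>i\<in>I. c \<odot>\<^bsub>M i\<^esub> u i)\<rparr>"

definition self_module :: "'k ring \<Rightarrow> ('k, 'k) module" where
  "self_module k =
    \<lparr>carrier = carrier k, mult = mult k, one = one k, zero = zero k, add = add k, smult = mult k\<rparr>"

definition free_module :: "'k ring \<Rightarrow> 's set \<Rightarrow> ('k, 's \<Rightarrow> 'k) module" where
  "free_module k S = direct_sum S (\<lambda>_. self_module k)"

definition basis_vec :: "'k ring \<Rightarrow> 's set \<Rightarrow> 's \<Rightarrow> ('s \<Rightarrow> 'k)" where
  "basis_vec k S s = (\<lambda>t\<in>S. if t = s then \<one>\<^bsub>k\<^esub> else \<zero>\<^bsub>k\<^esub>)"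

definition submodule_gen :: "'k ring \<Rightarrow> ('k, 'b) module \<Rightarrow> 'b set \<Rightarrow> 'b set" where
  "submodule_gen k M S = \<Inter> {N. submodule N k M \<and> S \<subseteq> N}"

definition quotient_module :: "('k, 'b) module \<Rightarrow> 'b set \<Rightarrow> ('k, 'b set) module" where
  "quotient_module M N =
    \<lparr>carrier = a_rcosets\<^bsub>M\<^esub> N, mult = undefined, one = undefined, zero = N, add = set_add M,
     smult = (\<lambda>c X. \<Union>x\<in>X. N +>\<^bsub>M\<^esub> (c \<odot>\<^bsub>M\<^esub> x))\<rparr>"

text \<open>\<open>A\<^sup>\<otimes>\<^sup>n\<close>: the free module on the \<open>n\<close>-tuples (lists of length \<open>n\<close>) of elements of \<open>A\<close>, modulo
  additivity and homogeneity in every entry.\<close>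

definition tuples :: "('k, 'a) module \<Rightarrow> nat \<Rightarrow> 'a list set" where
  "tuples A n = {as. length as = n \<and> set as \<subseteq> carrier A}"

definition tensor_relators :: "'k ring \<Rightarrow> ('k, 'a) module \<Rightarrow> nat \<Rightarrow> ('a list \<Rightarrow> 'k) set" where
  "tensor_relators k A n =
    (let S = tuples A n; M = free_module k S; e = basis_vec k S in
      {e (as @ (x \<oplus>\<^bsub>A\<^esub> y) # bs) \<ominus>\<^bsub>M\<^esub> (e (as @ x # bs) \<oplus>\<^bsub>M\<^esub> e (as @ y # bs)) | as bs x y.
         as @ x # bs \<in> S \<and> y \<in> carrier A} \<union>
      {e (as @ (c \<odot>\<^bsub>A\<^esub> x) # bs) \<ominus>\<^bsub>M\<^esub> (c \<odot>\<^bsub>M\<^esub> e (as @ x # bs)) | as bs x c.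
         as @ x # bs \<in> S \<and> c \<in> carrier k})"

definition tensor_kernel :: "'k ring \<Rightarrow> ('k, 'a) module \<Rightarrow> nat \<Rightarrow> ('a list \<Rightarrow> 'k) set" where
  "tensor_kernel k A n = submodule_gen k (free_module k (tuples A n)) (tensor_relators k A n)"

definition tensor_power :: "'k ring \<Rightarrow> ('k, 'a) module \<Rightarrow> nat \<Rightarrow> ('k, ('a list \<Rightarrow> 'k) set) module" where
  "tensor_power k A n = quotient_module (free_module k (tuples A n)) (tensor_kernel k A n)"


section \<open>The free Rota-Baxter algebra \<open>Sha(A)\<close>\<close>

type_synonym ('k, 'a) sha = "nat \<Rightarrow> ('a list \<Rightarrow> 'k) set"

definition sha_module :: "'k ring \<Rightarrow> ('k, 'a) module \<Rightarrow> ('k, ('k, 'a) sha) module" where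
  "sha_module k A = direct_sum {1..} (tensor_power k A)"

text \<open>\<open>pure k A [a0, \<dots>, an]\<close> is \<open>a0 \<otimes> \<dots> \<otimes> an\<close>, placed in the summand \<open>A\<^sup>\<otimes>\<^sup>(\<^sup>n\<^sup>+\<^sup>1\<^sup>)\<close> of \<open>Sha(A)\<close>.\<close>

definition pure :: "'k ring \<Rightarrow> ('k, 'a) module \<Rightarrow> 'a list \<Rightarrow> ('k, 'a) sha" where
  "pure k A as =
    (\<lambda>i\<in>{1..}. if i = length as
       then tensor_kernel k A i +>\<^bsub>free_module k (tuples A i)\<^esub> basis_vec k (tuples A i) as
       else \<zero>\<^bsub>tensor_power k A i\<^esub>)"

text \<open>\<open>sha_lift k A M \<phi>\<close> is the linear map \<open>Sha(A) \<rightarrow> M\<close> with \<open>a0 \<otimes> \<dots> \<otimes> an \<mapsto> \<phi> [a0, \<dots>, an]\<close>. It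
  evaluates \<open>\<phi>\<close> on an arbitrary representative of each component, so it is meaningful when \<open>\<phi>\<close> is
  multilinear on the tuples of each length, which holds for every \<open>\<phi>\<close> used below.\<close>

definition tensor_lift ::
    "'k ring \<Rightarrow> ('k, 'a) module \<Rightarrow> ('k, 'b) module \<Rightarrow> ('a list \<Rightarrow> 'b) \<Rightarrow> nat \<Rightarrow> ('a list \<Rightarrow> 'k) set \<Rightarrow> 'b"
  where
  "tensor_lift k A M \<phi> n X =
    (let x = (SOME x. x \<in> X) in
      \<Oplus>\<^bsub>M\<^esub>as\<in>{as \<in> tuples A n. x as \<noteq> \<zero>\<^bsub>k\<^esub>}. x as \<odot>\<^bsub>M\<^esub> \<phi> as)"

definition sha_lift ::
    "'k ring \<Rightarrow> ('k, 'a) module \<Rightarrow> ('k, 'b) module \<Rightarrow> ('a list \<Rightarrow> 'b) \<Rightarrow> ('k, 'a) sha \<Rightarrow> 'b"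
  where
  "sha_lift k A M \<phi> u =
    (\<Oplus>\<^bsub>M\<^esub>i\<in>{i \<in> {1..}. u i \<noteq> \<zero>\<^bsub>tensor_power k A i\<^esub>}. tensor_lift k A M \<phi> i (u i))"

text \<open>\<open>a \<otimes> u\<close> for \<open>u \<in> Sha(A)\<close>.\<close>

definition sha_cons :: "'k ring \<Rightarrow> ('k, 'a) module \<Rightarrow> 'a \<Rightarrow> ('k, 'a) sha \<Rightarrow> ('k, 'a) sha" where
  "sha_cons k A a = sha_lift k A (sha_module k A) (\<lambda>as. pure k A (a # as))"

text \<open>The product \<open>\<diamond>\<close> on pure tensors. The empty list does not represent an element of \<open>Sha(A)\<close>.\<close>

fun pure_diamond ::
    "'k ring \<Rightarrow> 'k \<Rightarrow> ('k, 'a) module \<Rightarrow> 'a list \<Rightarrow> 'a list \<Rightarrow> ('k, 'a) sha" where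
  "pure_diamond k l A [] bs = undefined"
| "pure_diamond k l A (a # as) [] = undefined"
| "pure_diamond k l A [a] (b # bs) = pure k A ((a \<otimes>\<^bsub>A\<^esub> b) # bs)"
| "pure_diamond k l A (a # a' # as) [b] = pure k A ((a \<otimes>\<^bsub>A\<^esub> b) # a' # as)"
| "pure_diamond k l A (a # a' # as) (b # b' # bs) =
    sha_cons k A (a \<otimes>\<^bsub>A\<^esub> b)
     (pure_diamond k l A (a' # as) (\<one>\<^bsub>A\<^esub> # b' # bs)
      \<oplus>\<^bsub>sha_module k A\<^esub> pure_diamond k l A (\<one>\<^bsub>A\<^esub> # a' # as) (b' # bs)
      \<oplus>\<^bsub>sha_module k A\<^esub> (l \<odot>\<^bsub>sha_module k A\<^esub> pure_diamond k l A (a' # as) (b' # bs)))"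

definition diamond ::
    "'k ring \<Rightarrow> 'k \<Rightarrow> ('k, 'a) module \<Rightarrow> ('k, 'a) sha \<Rightarrow> ('k, 'a) sha \<Rightarrow> ('k, 'a) sha" where
  "diamond k l A u v =
    sha_lift k A (sha_module k A)
      (\<lambda>as. sha_lift k A (sha_module k A) (\<lambda>bs. pure_diamond k l A as bs) v) u"

definition Sha :: "'k ring \<Rightarrow> 'k \<Rightarrow> ('k, 'a) module \<Rightarrow> ('k, ('k, 'a) sha) module" where
  "Sha k l A =
    (sha_module k A)\<lparr>mult := diamond k l A, one := pure k A [\<one>\<^bsub>A\<^esub>]\<rparr>"

definition sha_P :: "'k ring \<Rightarrow> 'k \<Rightarrow> ('k, 'a) module \<Rightarrow> ('k, 'a) sha \<Rightarrow> ('k, 'a) sha" where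
  "sha_P k l A = (\<lambda>u\<in>carrier (Sha k l A). sha_cons k A \<one>\<^bsub>A\<^esub> u)"


section \<open>Algebras and Rota-Baxter algebras\<close>

text \<open>Maps defined on a carrier are required to be extensional, so that equality of functions is
  equality of maps on the carrier.\<close>

definition alg_hom :: "'k ring \<Rightarrow> ('k, 'a) module \<Rightarrow> ('k, 'b) module \<Rightarrow> ('a \<Rightarrow> 'b) set" where
  "alg_hom k A B =
    {f \<in> ring_hom A B \<inter> extensional (carrier A).
      \<forall>c\<in>carrier k. \<forall>x\<in>carrier A. f (c \<odot>\<^bsub>A\<^esub> x) = c \<odot>\<^bsub>B\<^esub> f x}"

definition linear_endo :: "'k ring \<Rightarrow> ('k, 'a) module \<Rightarrow> ('a \<Rightarrow> 'a) set" where
  "linear_endo k A =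
    {f \<in> carrier A \<rightarrow>\<^sub>E carrier A.
      (\<forall>x\<in>carrier A. \<forall>y\<in>carrier A. f (x \<oplus>\<^bsub>A\<^esub> y) = f x \<oplus>\<^bsub>A\<^esub> f y) \<and>
      (\<forall>c\<in>carrier k. \<forall>x\<in>carrier A. f (c \<odot>\<^bsub>A\<^esub> x) = c \<odot>\<^bsub>A\<^esub> f x)}"

definition rota_baxter_operator ::
    "'k ring \<Rightarrow> 'k \<Rightarrow> ('k, 'a) module \<Rightarrow> ('a \<Rightarrow> 'a) \<Rightarrow> bool" where
  "rota_baxter_operator k l R P \<longleftrightarrow>
    P \<in> linear_endo k R \<and>
    (\<forall>x\<in>carrier R. \<forall>y\<in>carrier R.
       P x \<otimes>\<^bsub>R\<^esub> P y = P (x \<otimes>\<^bsub>R\<^esub> P y) \<oplus>\<^bsub>R\<^esub> P (y \<otimes>\<^bsub>R\<^esub> P x) \<oplus>\<^bsub>R\<^esub> l \<odot>\<^bsub>R\<^esub> P (x \<otimes>\<^bsub>R\<^esub> y))"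

type_synonym ('k, 'a) rb = "('k, 'a) module \<times> ('a \<Rightarrow> 'a)"

definition rb_hom :: "'k ring \<Rightarrow> ('k, 'a) rb \<Rightarrow> ('k, 'b) rb \<Rightarrow> ('a \<Rightarrow> 'b) set" where
  "rb_hom k X Y =
    {f \<in> alg_hom k (fst X) (fst Y). \<forall>x\<in>carrier (fst X). f (snd X x) = snd Y (f x)}"

definition RBA :: "'k ring \<Rightarrow> 'k \<Rightarrow> (('k, 'a) rb, 'a \<Rightarrow> 'a) cat" where
  "RBA k l =
    \<lparr>Obj = {(R, P). algebra k R \<and> rota_baxter_operator k l R P},
     Hom = rb_hom k,
     Ide = (\<lambda>X. \<lambda>x\<in>carrier (fst X). x),
     Cmp = (\<lambda>X Y Z g f. compose (carrier (fst X)) g f)\<rparr>"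


section \<open>The adjunction, the monad \<open>T\<close> and its algebras\<close>

text \<open>The left adjoint \<open>F\<close> on objects, and \<open>T = U F\<close> on morphisms (on objects \<open>T\<close> is \<open>Sha k l\<close>).\<close>

definition free_rb :: "'k ring \<Rightarrow> 'k \<Rightarrow> ('k, 'a) module \<Rightarrow> ('k, ('k, 'a) sha) rb" where
  "free_rb k l A = (Sha k l A, sha_P k l A)"

definition T_map ::
    "'k ring \<Rightarrow> 'k \<Rightarrow> ('k, 'a) module \<Rightarrow> ('k, 'b) module \<Rightarrow> ('a \<Rightarrow> 'b)
      \<Rightarrow> ('k, 'a) sha \<Rightarrow> ('k, 'b) sha" where
  "T_map k l A B f =
    (\<lambda>u\<in>carrier (Sha k l A). sha_lift k A (Sha k l B) (\<lambda>as. pure k B (map f as)) u)"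

definition unit_eta :: "'k ring \<Rightarrow> ('k, 'a) module \<Rightarrow> 'a \<Rightarrow> ('k, 'a) sha" where
  "unit_eta k A = (\<lambda>a\<in>carrier A. pure k A [a])"

text \<open>\<open>a0 P(a1 P(\<dots> P(an) \<dots>))\<close>\<close>

fun nested_P :: "('k, 'a) rb \<Rightarrow> 'a list \<Rightarrow> 'a" where
  "nested_P X [] = undefined"
| "nested_P X [a] = a"
| "nested_P X (a # b # bs) = a \<otimes>\<^bsub>fst X\<^esub> snd X (nested_P X (b # bs))"

definition counit_eps :: "'k ring \<Rightarrow> 'k \<Rightarrow> ('k, 'a) rb \<Rightarrow> ('k, 'a) sha \<Rightarrow> 'a" where
  "counit_eps k l X =
    (\<lambda>u\<in>carrier (Sha k l (fst X)). sha_lift k (fst X) (fst X) (nested_P X) u)"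

definition mult_mu ::
    "'k ring \<Rightarrow> 'k \<Rightarrow> ('k, 'a) module \<Rightarrow> ('k, ('k, 'a) sha) sha \<Rightarrow> ('k, 'a) sha" where
  "mult_mu k l A = counit_eps k l (free_rb k l A)"

type_synonym ('k, 'a) talg = "('k, 'a) module \<times> (('k, 'a) sha \<Rightarrow> 'a)"

definition is_T_algebra :: "'k ring \<Rightarrow> 'k \<Rightarrow> ('k, 'a) talg \<Rightarrow> bool" where
  "is_T_algebra k l X \<longleftrightarrow>
    (case X of (A, h) \<Rightarrow>
      algebra k A \<and>
      h \<in> alg_hom k (Sha k l A) A \<and>
      (\<forall>a\<in>carrier A. h (unit_eta k A a) = a) \<and>
      (\<forall>u\<in>carrier (Sha k l (Sha k l A)).
         h (T_map k l (Sha k l A) A h u) = h (mult_mu k l A u)))"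

definition T_algebra_hom :: "'k ring \<Rightarrow> 'k \<Rightarrow> ('k, 'a) talg \<Rightarrow> ('k, 'b) talg \<Rightarrow> ('a \<Rightarrow> 'b) set" where
  "T_algebra_hom k l X Y =
    {\<phi> \<in> alg_hom k (fst X) (fst Y).
      \<forall>u\<in>carrier (Sha k l (fst X)).
        snd Y (T_map k l (fst X) (fst Y) \<phi> u) = \<phi> (snd X u)}"

definition ALG_T :: "'k ring \<Rightarrow> 'k \<Rightarrow> (('k, 'a) talg, 'a \<Rightarrow> 'a) cat" where
  "ALG_T k l =
    \<lparr>Obj = {X. is_T_algebra k l X},
     Hom = T_algebra_hom k l,
     Ide = (\<lambda>X. \<lambda>x\<in>carrier (fst X). x),
     Cmp = (\<lambda>X Y Z g f. compose (carrier (fst X)) g f)\<rparr>"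

definition comparison ::
    "'k ring \<Rightarrow> 'k \<Rightarrow> (('k, 'a) rb, 'a \<Rightarrow> 'a, ('k, 'a) talg, 'a \<Rightarrow> 'a) cat_fun" where
  "comparison k l =
    \<lparr>on_obj = (\<lambda>X. (fst X, counit_eps k l X)), on_hom = (\<lambda>X Y f. f)\<rparr>"

end

theory Submission
  imports Defs
begin

text \<open>A T-algebra structure \<open>h : Sha(A) \<rightarrow> A\<close> carries no more information than its values
  \<open>P(a) = h(1 \<otimes> a)\<close>.  Indeed \<open>a \<otimes> u = a \<diamond> (1 \<otimes> u)\<close>, and \<open>h\<close> is multiplicative and the identity on
  \<open>A\<close>, so \<open>h(a \<otimes> u) = a h(1 \<otimes> u)\<close>; and the associativity law at the pure tensor of \<open>1\<close> and \<open>u\<close> in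
  \<open>Sha(Sha(A))\<close> says \<open>h(1 \<otimes> u) = P(h(u))\<close>.  Hence \<open>h\<close> maps \<open>a0 \<otimes> \<dots> \<otimes> an\<close> to
  \<open>a0 P(a1 P(\<dots> P(an) \<dots>))\<close>, which is the counit of \<open>(A, P)\<close> (\<open>counit_operator_of\<close>).  Applying \<open>h\<close>
  to \<open>(1 \<otimes> x) \<diamond> (1 \<otimes> y) = 1 \<otimes> (x \<otimes> y + y \<otimes> x + \<lambda> x y)\<close> gives the Rota-Baxter identity
  for \<open>P\<close> (\<open>operator_of_rota_baxter\<close>).

  Conversely, for a Rota-Baxter operator \<open>P\<close> the recursion that defines \<open>\<diamond>\<close> mirrors the Rota-Baxter
  identity, and this makes the counit multiplicative (\<open>eps_diamond\<close>).  Since the counit moreover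
  turns \<open>P\<^sub>A\<close> into \<open>P\<close>, it respects nested expressions, which is the associativity law
  (\<open>counit_T_algebra\<close>); and \<open>P\<close> is recovered as its values at \<open>1 \<otimes> a\<close>.  So \<open>K\<close> is a bijection
  on objects.  An algebra homomorphism commutes with the operators if and only if it commutes with
  the counits (\<open>T_algebra_hom_counit\<close>), so \<open>K\<close> is the identity on hom-sets.

  Each of these computations takes place on pure tensors.  To extend them, \<open>Sha(A)\<close> needs its
  universal property as a module: the pure tensors span (\<open>sha_induct\<close>), so linear maps that agree on
  them are equal (\<open>linear_maps_eqI\<close>), and a multilinear function on tuples extends to a linear map
  (\<open>linear_map_sha_lift\<close>, \<open>sha_lift_pure\<close>).  It comes from the universal properties of direct sums
  and of quotients, of which \<open>Sha(A)\<close> is composed.  The maps involved are then linear once the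
  recursion for \<open>\<diamond>\<close> is known to be linear in every slot of both arguments
  (\<open>multilinear_pure_diamond\<close>).\<close>

section \<open>Linear and multilinear maps\<close>

text \<open>A map that depends linearly on a parameter is the recurring object: multilinearity is linearity
  in one slot with the others frozen, and bilinearity of the product on \<open>Sha(A)\<close> is obtained one
  variable at a time.  Values outside the carrier are left free, so that unrestricted
  \<open>\<lambda>\<close>-terms qualify.\<close>
definition linear_map :: "'k ring \<Rightarrow> ('k, 'a) module \<Rightarrow> ('k, 'b) module \<Rightarrow> ('a \<Rightarrow> 'b) \<Rightarrow> bool" where
  "linear_map k A M f \<longleftrightarrow>
    (\<forall>x\<in>carrier A. f x \<in> carrier M) \<and>
    (\<forall>x\<in>carrier A. \<forall>y\<in>carrier A. f (x \<oplus>\<^bsub>A\<^esub> y) = f x \<oplus>\<^bsub>M\<^esub> f y) \<and>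
    (\<forall>c\<in>carrier k. \<forall>x\<in>carrier A. f (c \<odot>\<^bsub>A\<^esub> x) = c \<odot>\<^bsub>M\<^esub> f x)"

lemma linear_mapI:
  assumes "\<And>x. x \<in> carrier A \<Longrightarrow> f x \<in> carrier M"
    and "\<And>x y. x \<in> carrier A \<Longrightarrow> y \<in> carrier A \<Longrightarrow> f (x \<oplus>\<^bsub>A\<^esub> y) = f x \<oplus>\<^bsub>M\<^esub> f y"
    and "\<And>c x. c \<in> carrier k \<Longrightarrow> x \<in> carrier A \<Longrightarrow> f (c \<odot>\<^bsub>A\<^esub> x) = c \<odot>\<^bsub>M\<^esub> f x"
  shows "linear_map k A M f"
  using assms by (simp add: linear_map_def)

lemma linear_mapD:
  assumes "linear_map k A M f"
  shows linear_map_closed: "\<And>x. x \<in> carrier A \<Longrightarrow> f x \<in> carrier M"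
    and linear_map_add: "\<And>x y. x \<in> carrier A \<Longrightarrow> y \<in> carrier A \<Longrightarrow> f (x \<oplus>\<^bsub>A\<^esub> y) = f x \<oplus>\<^bsub>M\<^esub> f y"
    and linear_map_smult: "\<And>c x. c \<in> carrier k \<Longrightarrow> x \<in> carrier A \<Longrightarrow> f (c \<odot>\<^bsub>A\<^esub> x) = c \<odot>\<^bsub>M\<^esub> f x"
  using assms by (simp_all add: linear_map_def)

lemma linear_map_zero:
  assumes "module k A" "module k M" "linear_map k A M f"
  shows "f \<zero>\<^bsub>A\<^esub> = \<zero>\<^bsub>M\<^esub>"
proof -
  interpret A: module k A by fact
  interpret M: module k M by fact
  have "f (\<zero>\<^bsub>k\<^esub> \<odot>\<^bsub>A\<^esub> \<zero>\<^bsub>A\<^esub>) = \<zero>\<^bsub>k\<^esub> \<odot>\<^bsub>M\<^esub> f \<zero>\<^bsub>A\<^esub>"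
    using assms(3) by (simp add: linear_map_smult del: A.smult_l_null A.smult_r_null)
  then show ?thesis using linear_map_closed[OF assms(3)] by simp
qed

lemma linear_map_minus:
  assumes "module k A" "module k M" "linear_map k A M f" "x \<in> carrier A" "y \<in> carrier A"
  shows "f (x \<ominus>\<^bsub>A\<^esub> y) = f x \<ominus>\<^bsub>M\<^esub> f y"
proof -
  interpret A: module k A by fact
  interpret M: module k M by fact
  have "f (x \<ominus>\<^bsub>A\<^esub> y) \<oplus>\<^bsub>M\<^esub> f y = f (x \<ominus>\<^bsub>A\<^esub> y \<oplus>\<^bsub>A\<^esub> y)"
    using assms(3-5) by (simp add: linear_map_add)
  also have "x \<ominus>\<^bsub>A\<^esub> y \<oplus>\<^bsub>A\<^esub> y = x"
    using assms(4,5) by (simp add: a_minus_def A.a_assoc A.l_neg)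
  finally show ?thesis
    using linear_map_closed[OF assms(3)] assms(4,5) by (metis A.minus_closed M.add.inv_solve_right' a_minus_def)
qed

lemma linear_map_cong:
  assumes "module k A" "linear_map k A M f" "\<And>x. x \<in> carrier A \<Longrightarrow> g x = f x"
  shows "linear_map k A M g"
proof -
  interpret A: module k A by fact
  show ?thesis using assms(2,3) by (intro linear_mapI) (simp_all add: linear_mapD)
qed

lemma linear_map_comp:
  assumes "linear_map k A B f" "linear_map k B M g"
  shows "linear_map k A M (\<lambda>x. g (f x))"
  using assms by (intro linear_mapI) (simp_all add: linear_mapD)

lemma linear_map_id: "linear_map k A A (\<lambda>x. x)"
  by (intro linear_mapI) simp_all

lemma linear_map_sum:
  assumes "module k M" "linear_map k A M f" "linear_map k A M g"
  shows "linear_map k A M (\<lambda>x. f x \<oplus>\<^bsub>M\<^esub> g x)"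
proof -
  interpret M: module k M by fact
  show ?thesis using assms(2,3)
    by (intro linear_mapI) (simp_all add: linear_mapD M.smult_r_distr M.add.m_ac)
qed

lemma linear_map_scale:
  assumes "module k M" "linear_map k A M f" "c \<in> carrier k"
  shows "linear_map k A M (\<lambda>x. c \<odot>\<^bsub>M\<^esub> f x)"
proof -
  interpret M: module k M by fact
  show ?thesis using assms(2,3)
    by (intro linear_mapI)
      (simp_all add: linear_mapD M.smult_r_distr M.smult_assoc1[symmetric] M.R.m_comm)
qed

text \<open>Displaying a slot restricts attention to nonempty lists.  This matches \<open>Sha(A)\<close>, which
  starts with the first tensor power, and functions such as \<open>nested_P\<close>, which are undefined at \<open>[]\<close>.\<close>
definition multilinear :: "'k ring \<Rightarrow> ('k, 'a) module \<Rightarrow> ('k, 'b) module \<Rightarrow> ('a list \<Rightarrow> 'b) \<Rightarrow> bool" where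
  "multilinear k A M \<phi> \<longleftrightarrow>
    (\<forall>as bs. set as \<subseteq> carrier A \<longrightarrow> set bs \<subseteq> carrier A \<longrightarrow> linear_map k A M (\<lambda>x. \<phi> (as @ x # bs)))"

lemma multilinearI:
  assumes "\<And>as bs. set as \<subseteq> carrier A \<Longrightarrow> set bs \<subseteq> carrier A \<Longrightarrow> linear_map k A M (\<lambda>x. \<phi> (as @ x # bs))"
  shows "multilinear k A M \<phi>"
  using assms by (simp add: multilinear_def)

lemma multilinearD:
  assumes "multilinear k A M \<phi>" "set as \<subseteq> carrier A" "set bs \<subseteq> carrier A"
  shows "linear_map k A M (\<lambda>x. \<phi> (as @ x # bs))"
  using assms by (simp add: multilinear_def)

lemma multilinear_closed:
  assumes "multilinear k A M \<phi>" "set as \<subseteq> carrier A" "as \<noteq> []"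
  shows "\<phi> as \<in> carrier M"
proof (cases as)
  case (Cons a bs)
  then show ?thesis using assms linear_map_closed[OF multilinearD[OF assms(1), of "[]" bs], of a] by simp
qed (use assms in simp)

section \<open>Direct sums\<close>

lemma direct_sum_add: "u \<oplus>\<^bsub>direct_sum I M\<^esub> v = (\<lambda>i\<in>I. u i \<oplus>\<^bsub>M i\<^esub> v i)"
  by (simp add: direct_sum_def)

lemma direct_sum_zero: "\<zero>\<^bsub>direct_sum I M\<^esub> = (\<lambda>i\<in>I. \<zero>\<^bsub>M i\<^esub>)"
  by (simp add: direct_sum_def)

lemma direct_sum_smult: "c \<odot>\<^bsub>direct_sum I M\<^esub> u = (\<lambda>i\<in>I. c \<odot>\<^bsub>M i\<^esub> u i)"
  by (simp add: direct_sum_def)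

text \<open>The inclusion of a summand.  Both the basis vectors of a free module and the pure tensors in
  \<open>Sha(A)\<close> are values of it.\<close>
definition single :: "'i set \<Rightarrow> ('i \<Rightarrow> ('k, 'b) module) \<Rightarrow> 'i \<Rightarrow> 'b \<Rightarrow> 'i \<Rightarrow> 'b" where
  "single I M i m = (\<lambda>j\<in>I. if j = i then m else \<zero>\<^bsub>M j\<^esub>)"

text \<open>The map out of a direct sum induced by maps out of its summands, written with the sum over the
  exact support; \<open>tensor_lift\<close> and \<open>sha_lift\<close> are both built from it.\<close>
definition direct_sum_lift ::
    "'i set \<Rightarrow> ('i \<Rightarrow> ('k, 'b) module) \<Rightarrow> ('k, 'c) module \<Rightarrow> ('i \<Rightarrow> 'b \<Rightarrow> 'c) \<Rightarrow> ('i \<Rightarrow> 'b) \<Rightarrow> 'c"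
  where "direct_sum_lift I M N f u = (\<Oplus>\<^bsub>N\<^esub>i\<in>{i \<in> I. u i \<noteq> \<zero>\<^bsub>M i\<^esub>}. f i (u i))"

locale module_family =
  fixes k :: "'k ring" and I :: "'i set" and M :: "'i \<Rightarrow> ('k, 'b) module"
  assumes k: "cring k" and M: "\<And>i. i \<in> I \<Longrightarrow> module k (M i)"
begin

lemma carrier_direct_sum:
  "carrier (direct_sum I M) = {u \<in> \<Pi>\<^sub>E i\<in>I. carrier (M i). finite {i \<in> I. u i \<noteq> \<zero>\<^bsub>M i\<^esub>}}"
proof -
  have "group (add_monoid (M i))" if "i \<in> I" for i
    using M[OF that] by (simp add: module_def abelian_group.a_group)
  then show ?thesis by (simp add: direct_sum_def carrier_sum_group)
qed

lemma component_closed: "u \<in> carrier (direct_sum I M) \<Longrightarrow> i \<in> I \<Longrightarrow> u i \<in> carrier (M i)"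
  by (auto simp: carrier_direct_sum)

lemma finite_support: "u \<in> carrier (direct_sum I M) \<Longrightarrow> finite {i \<in> I. u i \<noteq> \<zero>\<^bsub>M i\<^esub>}"
  by (simp add: carrier_direct_sum)

lemma direct_sum_eqI:
  assumes "u \<in> carrier (direct_sum I M)" "v \<in> carrier (direct_sum I M)" "\<And>i. i \<in> I \<Longrightarrow> u i = v i"
  shows "u = v"
  using assms by (auto simp: carrier_direct_sum intro: PiE_ext)

lemma component_zero:
  assumes "i \<in> I"
  shows "\<zero>\<^bsub>M i\<^esub> \<in> carrier (M i)"
    and "x \<in> carrier (M i) \<Longrightarrow> \<zero>\<^bsub>M i\<^esub> \<oplus>\<^bsub>M i\<^esub> x = x"
    and "x \<in> carrier (M i) \<Longrightarrow> x \<oplus>\<^bsub>M i\<^esub> \<zero>\<^bsub>M i\<^esub> = x"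
proof -
  interpret Mi: module k "M i" by (rule M[OF assms])
  show "\<zero>\<^bsub>M i\<^esub> \<in> carrier (M i)"
    and "x \<in> carrier (M i) \<Longrightarrow> \<zero>\<^bsub>M i\<^esub> \<oplus>\<^bsub>M i\<^esub> x = x"
    and "x \<in> carrier (M i) \<Longrightarrow> x \<oplus>\<^bsub>M i\<^esub> \<zero>\<^bsub>M i\<^esub> = x" by simp_all
qed

lemma module_direct_sum: "module k (direct_sum I M)"
proof (rule moduleI)
  have ab: "abelian_group (M i)" if "i \<in> I" for i using M[OF that] by (simp add: module_def)
  show "cring k" by (rule k)
  have grp: "group (add_monoid (M i))" if "i \<in> I" for i
    using ab[OF that] by (simp add: abelian_group.a_group)
  have cg: "comm_group (add_monoid (direct_sum I M))"
  proof (rule group.group_comm_groupI)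
    have "group (sum_group I (\<lambda>i. add_monoid (M i)))" using grp by simp
    then show "group (add_monoid (direct_sum I M))"
      by (simp add: group_def monoid_def group_axioms_def Units_def direct_sum_def)
    fix u v assume u: "u \<in> carrier (add_monoid (direct_sum I M))" and v: "v \<in> carrier (add_monoid (direct_sum I M))"
    then have "u i \<oplus>\<^bsub>M i\<^esub> v i = v i \<oplus>\<^bsub>M i\<^esub> u i" if "i \<in> I" for i
      using component_closed that ab[OF that] by (simp add: abelian_group_def abelian_monoid.a_comm)
    then show "u \<otimes>\<^bsub>add_monoid (direct_sum I M)\<^esub> v = v \<otimes>\<^bsub>add_monoid (direct_sum I M)\<^esub> u"
      by (auto simp: direct_sum_add intro: restrict_ext)
  qed
  then show "abelian_group (direct_sum I M)" by (rule comm_group_abelian_groupI)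
  fix c d u v
  assume c: "c \<in> carrier k" and d: "d \<in> carrier k" and u: "u \<in> carrier (direct_sum I M)" and v: "v \<in> carrier (direct_sum I M)"
  have "{i \<in> I. c \<odot>\<^bsub>M i\<^esub> u i \<noteq> \<zero>\<^bsub>M i\<^esub>} \<subseteq> {i \<in> I. u i \<noteq> \<zero>\<^bsub>M i\<^esub>}"
    using c by (auto simp: module.smult_r_null[OF M])
  then have "finite {i \<in> I. c \<odot>\<^bsub>M i\<^esub> u i \<noteq> \<zero>\<^bsub>M i\<^esub>}" using finite_support[OF u] by (rule finite_subset)
  then show cu: "c \<odot>\<^bsub>direct_sum I M\<^esub> u \<in> carrier (direct_sum I M)"
    using u c M by (auto simp: carrier_direct_sum direct_sum_smult module.smult_closed[OF M] PiE_iff cong: conj_cong)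
  note U = component_closed[OF u] note V = component_closed[OF v]
  show "(c \<oplus>\<^bsub>k\<^esub> d) \<odot>\<^bsub>direct_sum I M\<^esub> u = c \<odot>\<^bsub>direct_sum I M\<^esub> u \<oplus>\<^bsub>direct_sum I M\<^esub> d \<odot>\<^bsub>direct_sum I M\<^esub> u"
    using U M c d by (auto simp: direct_sum_add direct_sum_smult module.smult_l_distr intro: restrict_ext)
  show "c \<odot>\<^bsub>direct_sum I M\<^esub> (u \<oplus>\<^bsub>direct_sum I M\<^esub> v) = c \<odot>\<^bsub>direct_sum I M\<^esub> u \<oplus>\<^bsub>direct_sum I M\<^esub> c \<odot>\<^bsub>direct_sum I M\<^esub> v"
    using U V M c d by (auto simp: direct_sum_add direct_sum_smult module.smult_r_distr[OF M] fun_eq_iff)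
  show "(c \<otimes>\<^bsub>k\<^esub> d) \<odot>\<^bsub>direct_sum I M\<^esub> u = c \<odot>\<^bsub>direct_sum I M\<^esub> (d \<odot>\<^bsub>direct_sum I M\<^esub> u)"
    using U M c d by (auto simp: direct_sum_smult module.smult_assoc1 intro: restrict_ext)
next
  fix u assume u: "u \<in> carrier (direct_sum I M)"
  have "\<one>\<^bsub>k\<^esub> \<odot>\<^bsub>M i\<^esub> u i = u i" if "i \<in> I" for i
    using component_closed[OF u that] M[OF that] by (simp add: module.smult_one)
  then show "\<one>\<^bsub>k\<^esub> \<odot>\<^bsub>direct_sum I M\<^esub> u = u"
    using u by (auto simp: carrier_direct_sum direct_sum_smult fun_eq_iff PiE_iff extensional_def)
qed

lemma single_closed:
  assumes "i \<in> I" "m \<in> carrier (M i)"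
  shows "single I M i m \<in> carrier (direct_sum I M)"
proof -
  have "finite {j \<in> I. single I M i m j \<noteq> \<zero>\<^bsub>M j\<^esub>}"
    by (rule finite_subset[of _ "{i}"]) (auto simp: single_def)
  then show ?thesis using assms component_zero(1) by (auto simp: carrier_direct_sum single_def)
qed

lemma linear_map_single:
  assumes i: "i \<in> I"
  shows "linear_map k (M i) (direct_sum I M) (single I M i)"
proof (rule linear_mapI)
  fix x y c assume x: "x \<in> carrier (M i)" and y: "y \<in> carrier (M i)"
  show "single I M i (x \<oplus>\<^bsub>M i\<^esub> y) = single I M i x \<oplus>\<^bsub>direct_sum I M\<^esub> single I M i y"
    by (auto simp: direct_sum_add single_def fun_eq_iff component_zero)
next
  fix x c assume c: "c \<in> carrier k"
  show "single I M i (c \<odot>\<^bsub>M i\<^esub> x) = c \<odot>\<^bsub>direct_sum I M\<^esub> single I M i x"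
    using c by (auto simp: direct_sum_smult single_def fun_eq_iff module.smult_r_null[OF M])
qed (rule single_closed[OF i])

text \<open>A finitely supported family is a finite sum of elements of the summands: peel off one index of
  the support at a time.\<close>
lemma direct_sum_induct [consumes 1, case_names zero single add]:
  assumes u: "u \<in> carrier (direct_sum I M)"
    and Z: "Q \<zero>\<^bsub>direct_sum I M\<^esub>"
    and S: "\<And>i m. i \<in> I \<Longrightarrow> m \<in> carrier (M i) \<Longrightarrow> Q (single I M i m)"
    and A: "\<And>u v. u \<in> carrier (direct_sum I M) \<Longrightarrow> v \<in> carrier (direct_sum I M) \<Longrightarrow> Q u \<Longrightarrow> Q v
              \<Longrightarrow> Q (u \<oplus>\<^bsub>direct_sum I M\<^esub> v)"
  shows "Q u"
proof -
  interpret D: module k "direct_sum I M" by (rule module_direct_sum)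
  have "Q u" if "finite F" "u \<in> carrier (direct_sum I M)" "{i \<in> I. u i \<noteq> \<zero>\<^bsub>M i\<^esub>} \<subseteq> F" for F u
    using that
  proof (induction F arbitrary: u)
    case empty
    then have "u = \<zero>\<^bsub>direct_sum I M\<^esub>"
      by (intro direct_sum_eqI D.zero_closed) (auto simp: direct_sum_zero)
    then show ?case using Z by simp
  next
    case (insert i F)
    show ?case
    proof (cases "i \<in> I")
      case False
      then show ?thesis using insert by auto
    next
      case True
      have ui: "u i \<in> carrier (M i)" using component_closed insert.prems(1) True .
      define v where "v = (\<lambda>j\<in>I. if j = i then \<zero>\<^bsub>M j\<^esub> else u j)"
      have sub: "{j \<in> I. v j \<noteq> \<zero>\<^bsub>M j\<^esub>} \<subseteq> F" using insert.prems(2) by (auto simp: v_def)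
      have v: "v \<in> carrier (direct_sum I M)"
        using insert.prems(1) component_zero(1) finite_subset[OF sub insert.hyps(1)]
        by (auto simp: carrier_direct_sum v_def)
      have "u = single I M i (u i) \<oplus>\<^bsub>direct_sum I M\<^esub> v"
      proof (rule direct_sum_eqI)
        fix j assume j: "j \<in> I"
        show "u j = (single I M i (u i) \<oplus>\<^bsub>direct_sum I M\<^esub> v) j"
          using j component_closed[OF insert.prems(1) j] by (auto simp: component_zero direct_sum_add single_def v_def)
      qed (use insert.prems(1) v single_closed[OF True ui] in auto)
      then show ?thesis
        using A[OF single_closed[OF True ui] v S[OF True ui] insert.IH[OF v sub]] by simp
    qed
  qed
  from this[OF finite_support[OF u] u] show ?thesis by simp
qed

context
  fixes N :: "('k, 'c) module" and f :: "'i \<Rightarrow> 'b \<Rightarrow> 'c"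
  assumes N: "module k N" and f: "\<And>i. i \<in> I \<Longrightarrow> linear_map k (M i) N (f i)"
begin

text \<open>The support of a sum need not be the union of the supports.  Summing over any larger finite
  index set gives the same value, so that two families can be compared over a common index set.\<close>
lemma direct_sum_lift_superset:
  assumes u: "u \<in> carrier (direct_sum I M)" and F: "finite F" "{i \<in> I. u i \<noteq> \<zero>\<^bsub>M i\<^esub>} \<subseteq> F" "F \<subseteq> I"
  shows "direct_sum_lift I M N f u = (\<Oplus>\<^bsub>N\<^esub>i\<in>F. f i (u i))"
proof -
  interpret N: module k N by (rule N)
  show ?thesis unfolding direct_sum_lift_def
  proof (rule N.add.finprod_mono_neutral_cong_left)
    fix i assume "i \<in> F - {i \<in> I. u i \<noteq> \<zero>\<^bsub>M i\<^esub>}"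
    then show "f i (u i) = \<zero>\<^bsub>N\<^esub>" using F linear_map_zero[OF M N f] by auto
  next
    show "(\<lambda>i. f i (u i)) \<in> F \<rightarrow> carrier N"
      using F component_closed[OF u] linear_map_closed[OF f] by blast
  qed (use F in auto)
qed

lemma linear_map_direct_sum_lift: "linear_map k (direct_sum I M) N (direct_sum_lift I M N f)"
proof -
  interpret N: module k N by (rule N)
  interpret D: module k "direct_sum I M" by (rule module_direct_sum)
  have fc: "(\<lambda>i. f i (u i)) \<in> F \<rightarrow> carrier N" if "u \<in> carrier (direct_sum I M)" "F \<subseteq> I" for u F
    using that component_closed[OF that(1)] linear_map_closed[OF f] by blast
  show ?thesis
  proof (rule linear_mapI)
    fix u assume u: "u \<in> carrier (direct_sum I M)"
    show "direct_sum_lift I M N f u \<in> carrier N"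
      unfolding direct_sum_lift_def by (rule N.finsum_closed[OF fc[OF u]]) auto
  next
    fix u v assume u: "u \<in> carrier (direct_sum I M)" and v: "v \<in> carrier (direct_sum I M)"
    let ?F = "{i \<in> I. u i \<noteq> \<zero>\<^bsub>M i\<^esub>} \<union> {i \<in> I. v i \<noteq> \<zero>\<^bsub>M i\<^esub>}"
    have fin: "finite ?F" using finite_support u v by auto
    have sub: "{i \<in> I. (u \<oplus>\<^bsub>direct_sum I M\<^esub> v) i \<noteq> \<zero>\<^bsub>M i\<^esub>} \<subseteq> ?F"
      by (auto simp: direct_sum_add component_zero)
    have "direct_sum_lift I M N f (u \<oplus>\<^bsub>direct_sum I M\<^esub> v) = (\<Oplus>\<^bsub>N\<^esub>i\<in>?F. f i ((u \<oplus>\<^bsub>direct_sum I M\<^esub> v) i))"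
      using u v fin sub by (intro direct_sum_lift_superset) auto
    also have "\<dots> = (\<Oplus>\<^bsub>N\<^esub>i\<in>?F. f i (u i) \<oplus>\<^bsub>N\<^esub> f i (v i))"
      using fc[OF u, of ?F] fc[OF v, of ?F]
      by (intro N.finsum_cong')
        (auto simp: direct_sum_add linear_map_add[OF f] component_closed[OF u] component_closed[OF v])
    also have "\<dots> = (\<Oplus>\<^bsub>N\<^esub>i\<in>?F. f i (u i)) \<oplus>\<^bsub>N\<^esub> (\<Oplus>\<^bsub>N\<^esub>i\<in>?F. f i (v i))"
      using fc[OF u, of ?F] fc[OF v, of ?F] by (intro N.finsum_addf) auto
    also have "\<dots> = direct_sum_lift I M N f u \<oplus>\<^bsub>N\<^esub> direct_sum_lift I M N f v"
      using direct_sum_lift_superset[OF u fin] direct_sum_lift_superset[OF v fin] by auto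
    finally show "direct_sum_lift I M N f (u \<oplus>\<^bsub>direct_sum I M\<^esub> v) = direct_sum_lift I M N f u \<oplus>\<^bsub>N\<^esub> direct_sum_lift I M N f v" .
  next
    fix c u assume c: "c \<in> carrier k" and u: "u \<in> carrier (direct_sum I M)"
    let ?F = "{i \<in> I. u i \<noteq> \<zero>\<^bsub>M i\<^esub>}"
    have fin: "finite ?F" using finite_support u by auto
    have sub: "{i \<in> I. (c \<odot>\<^bsub>direct_sum I M\<^esub> u) i \<noteq> \<zero>\<^bsub>M i\<^esub>} \<subseteq> ?F"
      using c by (auto simp: direct_sum_smult module.smult_r_null[OF M])
    have "direct_sum_lift I M N f (c \<odot>\<^bsub>direct_sum I M\<^esub> u) = (\<Oplus>\<^bsub>N\<^esub>i\<in>?F. f i ((c \<odot>\<^bsub>direct_sum I M\<^esub> u) i))"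
      using u c fin sub by (intro direct_sum_lift_superset) auto
    also have "\<dots> = (\<Oplus>\<^bsub>N\<^esub>i\<in>?F. c \<odot>\<^bsub>N\<^esub> f i (u i))"
      using fc[OF u, of ?F] c
      by (intro N.finsum_cong') (auto simp: direct_sum_smult linear_map_smult[OF f] component_closed[OF u])
    also have "\<dots> = c \<odot>\<^bsub>N\<^esub> direct_sum_lift I M N f u"
      using fc[OF u, of ?F] fin c by (simp add: direct_sum_lift_def N.finsum_smult_ldistr)
    finally show "direct_sum_lift I M N f (c \<odot>\<^bsub>direct_sum I M\<^esub> u) = c \<odot>\<^bsub>N\<^esub> direct_sum_lift I M N f u" .
  qed
qed

lemma direct_sum_lift_single:
  assumes i: "i \<in> I" and m: "m \<in> carrier (M i)"
  shows "direct_sum_lift I M N f (single I M i m) = f i m"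
proof -
  interpret N: module k N by (rule N)
  have "direct_sum_lift I M N f (single I M i m) = (\<Oplus>\<^bsub>N\<^esub>j\<in>{i}. f j (single I M i m j))"
    using i by (intro direct_sum_lift_superset single_closed i m) (auto simp: single_def)
  also have "\<dots> = f i m" using linear_map_closed[OF f[OF i] m] i by (simp add: single_def)
  finally show ?thesis .
qed

end

end

section \<open>Quotient modules\<close>

text \<open>For a linear map to vanish on the submodule generated by some relators it suffices that it
  vanishes on the relators, since its kernel is a submodule.\<close>
lemma submodule_kernel:
  assumes "module k M" "module k N" "linear_map k M N f"
  shows "submodule {x \<in> carrier M. f x = \<zero>\<^bsub>N\<^esub>} k M"
proof -
  interpret M: module k M by fact
  interpret N: module k N by fact
  show ?thesis
  proof (rule M.submoduleI)
    fix a assume a: "a \<in> {x \<in> carrier M. f x = \<zero>\<^bsub>N\<^esub>}"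
    have "\<ominus>\<^bsub>M\<^esub> a = (\<ominus>\<^bsub>k\<^esub> \<one>\<^bsub>k\<^esub>) \<odot>\<^bsub>M\<^esub> a" using a by (simp add: M.smult_l_minus)
    then have "f (\<ominus>\<^bsub>M\<^esub> a) = \<zero>\<^bsub>N\<^esub>" using a by (simp add: linear_map_smult[OF assms(3)])
    then show "\<ominus>\<^bsub>M\<^esub> a \<in> {x \<in> carrier M. f x = \<zero>\<^bsub>N\<^esub>}" using a by simp
  qed (auto simp: linear_map_zero[OF assms] linear_mapD[OF assms(3)])
qed

lemma submodule_gen:
  assumes "module k M" "S \<subseteq> carrier M"
  shows submodule_gen_submodule: "submodule (submodule_gen k M S) k M"
    and submodule_gen_superset: "S \<subseteq> submodule_gen k M S"
    and submodule_gen_least: "\<And>N. submodule N k M \<Longrightarrow> S \<subseteq> N \<Longrightarrow> submodule_gen k M S \<subseteq> N"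
proof -
  interpret M: module k M by fact
  have top: "carrier M \<in> {N. submodule N k M \<and> S \<subseteq> N}" using M.carrier_is_submodule assms(2) by simp
  show "submodule (submodule_gen k M S) k M"
  proof (rule M.submoduleI)
    show "submodule_gen k M S \<subseteq> carrier M" using top by (auto simp: submodule_gen_def)
    show "\<zero>\<^bsub>M\<^esub> \<in> submodule_gen k M S"
      by (auto simp: submodule_gen_def submodule_def subgroup_def)
  qed (auto simp: submodule_gen_def M.submoduleE)
  show "S \<subseteq> submodule_gen k M S" by (auto simp: submodule_gen_def)
  show "\<And>N. submodule N k M \<Longrightarrow> S \<subseteq> N \<Longrightarrow> submodule_gen k M S \<subseteq> N"
    by (auto simp: submodule_gen_def)
qed

locale submodule_of_module =
  fixes k :: "'k ring" and M :: "('k, 'b) module" and N :: "'b set"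
  assumes M: "module k M" and N: "submodule N k M"
begin

interpretation M: module k M by (rule M)

lemma abelian_subgroup: "abelian_subgroup N M"
  using N M.abelian_group_axioms by (intro abelian_subgroupI3 additive_subgroupI) (auto simp: submodule_def)

interpretation N: abelian_subgroup N M by (rule abelian_subgroup)

lemma carrier_quotient: "carrier (quotient_module M N) = (\<lambda>x. N +>\<^bsub>M\<^esub> x) ` carrier M"
  by (auto simp: quotient_module_def A_RCOSETS_def')

lemma quotient_add:
  assumes "x \<in> carrier M" "y \<in> carrier M"
  shows "(N +>\<^bsub>M\<^esub> x) \<oplus>\<^bsub>quotient_module M N\<^esub> (N +>\<^bsub>M\<^esub> y) = N +>\<^bsub>M\<^esub> (x \<oplus>\<^bsub>M\<^esub> y)"
  using assms by (simp add: quotient_module_def N.a_rcos_sum)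

lemma quotient_zero: "\<zero>\<^bsub>quotient_module M N\<^esub> = N +>\<^bsub>M\<^esub> \<zero>\<^bsub>M\<^esub>"
  by (simp add: quotient_module_def N.a_subset)

lemma mem_cosetD:
  assumes "x \<in> carrier M" "y \<in> N +>\<^bsub>M\<^esub> x"
  shows "\<exists>n\<in>N. y = n \<oplus>\<^bsub>M\<^esub> x"
  using assms by (auto simp: a_r_coset_def')

lemma coset_absorb:
  assumes "n \<in> N" "x \<in> carrier M"
  shows "N +>\<^bsub>M\<^esub> (n \<oplus>\<^bsub>M\<^esub> x) = N +>\<^bsub>M\<^esub> x"
  using assms N.a_subgroup N.a_subset
  by (metis M.a_rcosI M.a_repr_independence)

lemma coset_eqI:
  assumes "x \<in> carrier M" "y \<in> carrier M" "x \<ominus>\<^bsub>M\<^esub> y \<in> N"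
  shows "N +>\<^bsub>M\<^esub> x = N +>\<^bsub>M\<^esub> y"
  using coset_absorb[OF assms(3,2)] assms(1,2) by (simp add: a_minus_def M.a_assoc M.l_neg)

lemma quotient_smult:
  assumes c: "c \<in> carrier k" and x: "x \<in> carrier M"
  shows "c \<odot>\<^bsub>quotient_module M N\<^esub> (N +>\<^bsub>M\<^esub> x) = N +>\<^bsub>M\<^esub> (c \<odot>\<^bsub>M\<^esub> x)"
proof -
  have *: "N +>\<^bsub>M\<^esub> (c \<odot>\<^bsub>M\<^esub> y) = N +>\<^bsub>M\<^esub> (c \<odot>\<^bsub>M\<^esub> x)" if y: "y \<in> N +>\<^bsub>M\<^esub> x" for y
  proof -
    obtain n where n: "n \<in> N" "y = n \<oplus>\<^bsub>M\<^esub> x" using mem_cosetD[OF x y] by blast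
    then show ?thesis using N.a_subset c x
      by (simp add: subset_iff M.smult_r_distr coset_absorb M.submoduleE(4)[OF N])
  qed
  have "N +>\<^bsub>M\<^esub> x \<noteq> {}" using N.a_rcos_self[OF x] by blast
  then have "(\<Union>y\<in>N +>\<^bsub>M\<^esub> x. N +>\<^bsub>M\<^esub> (c \<odot>\<^bsub>M\<^esub> y)) = N +>\<^bsub>M\<^esub> (c \<odot>\<^bsub>M\<^esub> x)"
    by (rule SUP_eq_const) (rule *)
  then show ?thesis by (simp add: quotient_module_def)
qed

lemma module_quotient: "module k (quotient_module M N)"
proof (rule moduleI)
  show "cring k" by (rule M.R.is_cring)
  show "abelian_group (quotient_module M N)"
  proof (rule abelian_groupI)
    fix X assume "X \<in> carrier (quotient_module M N)"
    then obtain x where x: "x \<in> carrier M" "X = N +>\<^bsub>M\<^esub> x" by (auto simp: carrier_quotient)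
    show "\<exists>Y\<in>carrier (quotient_module M N). Y \<oplus>\<^bsub>quotient_module M N\<^esub> X = \<zero>\<^bsub>quotient_module M N\<^esub>"
      using x by (intro bexI[of _ "N +>\<^bsub>M\<^esub> (\<ominus>\<^bsub>M\<^esub> x)"])
        (auto simp: quotient_add quotient_zero carrier_quotient M.l_neg)
  qed (auto simp: carrier_quotient quotient_add quotient_zero M.add.m_ac)
qed (auto simp: carrier_quotient quotient_add quotient_smult M.smult_l_distr M.smult_r_distr M.smult_assoc1)

lemma linear_map_coset: "linear_map k M (quotient_module M N) (\<lambda>x. N +>\<^bsub>M\<^esub> x)"
  by (rule linear_mapI) (auto simp: carrier_quotient quotient_add quotient_smult)

text \<open>A map that kills \<open>N\<close> is constant on the cosets of \<open>N\<close>, so evaluating it at an arbitrarily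
  chosen representative is legitimate.\<close>
lemma quotient_lift_coset:
  assumes M': "module k M'" and f: "linear_map k M M' f" and z: "\<And>x. x \<in> N \<Longrightarrow> f x = \<zero>\<^bsub>M'\<^esub>"
    and x: "x \<in> carrier M"
  shows "f (SOME y. y \<in> N +>\<^bsub>M\<^esub> x) = f x"
proof -
  interpret M': module k M' by (rule M')
  have "(SOME y. y \<in> N +>\<^bsub>M\<^esub> x) \<in> N +>\<^bsub>M\<^esub> x" using N.a_rcos_self[OF x] by (rule someI)
  then obtain n where n: "n \<in> N" "(SOME y. y \<in> N +>\<^bsub>M\<^esub> x) = n \<oplus>\<^bsub>M\<^esub> x" using mem_cosetD[OF x] by blast
  then show ?thesis
    using x N.a_subset linear_map_closed[OF f x] by (simp add: subset_iff linear_map_add[OF f] z)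
qed

lemma linear_map_quotient_lift:
  assumes M': "module k M'" and f: "linear_map k M M' f" and z: "\<And>x. x \<in> N \<Longrightarrow> f x = \<zero>\<^bsub>M'\<^esub>"
  shows "linear_map k (quotient_module M N) M' (\<lambda>X. f (SOME y. y \<in> X))"
  by (rule linear_mapI)
    (auto simp: carrier_quotient quotient_add quotient_smult quotient_lift_coset[OF assms] linear_mapD[OF f])

end

section \<open>The universal property of the module \<open>Sha(A)\<close>\<close>

text \<open>\<open>Sha(A)\<close> is its underlying module with a product and a unit inserted; the module axioms do not
  see these fields.\<close>
lemma module_record_update:
  assumes "module k M"
  shows "module k (M\<lparr>mult := m, one := e\<rparr>)"
proof -
  interpret M: module k M by fact
  show ?thesis
  proof (rule moduleI)
    show "abelian_group (M\<lparr>mult := m, one := e\<rparr>)"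
    proof (rule abelian_groupI)
      fix x assume "x \<in> carrier (M\<lparr>mult := m, one := e\<rparr>)"
      then show "\<exists>y\<in>carrier (M\<lparr>mult := m, one := e\<rparr>).
          y \<oplus>\<^bsub>M\<lparr>mult := m, one := e\<rparr>\<^esub> x = \<zero>\<^bsub>M\<lparr>mult := m, one := e\<rparr>\<^esub>"
        by (auto intro: bexI[of _ "\<ominus>\<^bsub>M\<^esub> x"] simp: M.l_neg)
    qed (auto simp: M.add.m_ac)
  qed (auto simp: M.R.is_cring M.smult_l_distr M.smult_r_distr M.smult_assoc1)
qed

lemma self_module_sel [simp]:
  "carrier (self_module k) = carrier k" "\<zero>\<^bsub>self_module k\<^esub> = \<zero>\<^bsub>k\<^esub>"
  "x \<oplus>\<^bsub>self_module k\<^esub> y = x \<oplus>\<^bsub>k\<^esub> y" "x \<odot>\<^bsub>self_module k\<^esub> y = x \<otimes>\<^bsub>k\<^esub> y"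
  by (simp_all add: self_module_def)

lemma module_self_module:
  assumes "cring k"
  shows "module k (self_module k)"
proof -
  interpret cring k by fact
  show ?thesis
  proof (rule moduleI)
    show "abelian_group (self_module k)"
    proof (rule abelian_groupI)
      fix x assume "x \<in> carrier (self_module k)"
      then show "\<exists>y\<in>carrier (self_module k). y \<oplus>\<^bsub>self_module k\<^esub> x = \<zero>\<^bsub>self_module k\<^esub>"
        by (auto intro: bexI[of _ "\<ominus>\<^bsub>k\<^esub> x"] simp: l_neg)
    qed (auto simp: add.m_ac)
  qed (auto simp: is_cring l_distr r_distr m_assoc)
qed

lemma basis_vec_single: "basis_vec k S s = single S (\<lambda>_. self_module k) s \<one>\<^bsub>k\<^esub>"
  by (simp add: basis_vec_def single_def fun_eq_iff)

lemma pure_single: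
  "pure k A as = single {1..} (tensor_power k A) (length as)
    (tensor_kernel k A (length as) +>\<^bsub>free_module k (tuples A (length as))\<^esub>
      basis_vec k (tuples A (length as)) as)"
  by (auto simp: pure_def single_def fun_eq_iff)

locale tensor_module =
  fixes k :: "'k ring" and A :: "('k, 'a) module"
  assumes A: "module k A"
begin

interpretation A: module k A by (rule A)

abbreviation "free n \<equiv> free_module k (tuples A n)"
abbreviation "e n \<equiv> basis_vec k (tuples A n)"

sublocale F: module_family k "tuples A n" "\<lambda>_. self_module k" for n
  by (rule module_family.intro) (simp_all add: module_self_module A.R.is_cring)

lemma module_free: "module k (free n)"
  using F.module_direct_sum by (simp add: free_module_def)

lemma e_closed:
  assumes "as \<in> tuples A n"
  shows "e n as \<in> carrier (free n)"
  using F.single_closed[OF assms, of "\<one>\<^bsub>k\<^esub>"] by (simp add: basis_vec_single free_module_def)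

lemma append_tuples:
  "as @ x # bs \<in> tuples A n \<longleftrightarrow>
     set as \<subseteq> carrier A \<and> x \<in> carrier A \<and> set bs \<subseteq> carrier A \<and> n = length as + length bs + 1"
  by (auto simp: tuples_def)

lemma relators_closed: "tensor_relators k A n \<subseteq> carrier (free n)"
proof -
  interpret M: module k "free n" by (rule module_free)
  have "r \<in> carrier (free n)" if "r \<in> tensor_relators k A n" for r
    using that unfolding tensor_relators_def Let_def
    by (elim UnE CollectE exE conjE; hypsubst; intro M.minus_closed M.a_closed M.smult_closed e_closed)
      (simp_all add: append_tuples)
  then show ?thesis by blast
qed

sublocale Q: submodule_of_module k "free n" "tensor_kernel k A n" for n
  unfolding tensor_kernel_def
  by (rule submodule_of_module.intro) (rule module_free submodule_gen_submodule relators_closed)+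

lemma module_tensor_power: "module k (tensor_power k A n)"
  using Q.module_quotient by (simp add: tensor_power_def)

sublocale S: module_family k "{1..}" "tensor_power k A"
  by (rule module_family.intro) (simp_all add: A.R.is_cring module_tensor_power)

lemma module_sha: "module k (sha_module k A)"
  using S.module_direct_sum by (simp add: sha_module_def)

definition tensor :: "nat \<Rightarrow> 'a list \<Rightarrow> ('a list \<Rightarrow> 'k) set" where
  "tensor n as = tensor_kernel k A n +>\<^bsub>free n\<^esub> e n as"

lemma pure_tensor: "pure k A as = single {1..} (tensor_power k A) (length as) (tensor (length as) as)"
  by (simp add: tensor_def pure_single)

text \<open>The relators are exactly the obstructions to linearity of a slot, and they lie in the
  submodule that is factored out.\<close>
lemma linear_map_tensor:
  assumes as: "set as \<subseteq> carrier A" and bs: "set bs \<subseteq> carrier A" and n: "n = length as + length bs + 1"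
  shows "linear_map k A (tensor_power k A n) (\<lambda>x. tensor n (as @ x # bs))"
proof (rule linear_mapI)
  interpret M: module k "free n" by (rule module_free)
  have ex: "e n (as @ x # bs) \<in> carrier (free n)" if "x \<in> carrier A" for x
    using that as bs n by (intro e_closed) (simp add: append_tuples)
  have R: "tensor_relators k A n \<subseteq> tensor_kernel k A n"
    unfolding tensor_kernel_def by (rule submodule_gen_superset[OF module_free relators_closed])
  fix x assume x: "x \<in> carrier A"
  show "tensor n (as @ x # bs) \<in> carrier (tensor_power k A n)"
    by (simp add: tensor_def tensor_power_def Q.carrier_quotient ex x)
  {
    fix y assume y: "y \<in> carrier A"
    have "e n (as @ (x \<oplus>\<^bsub>A\<^esub> y) # bs) \<ominus>\<^bsub>free n\<^esub> (e n (as @ x # bs) \<oplus>\<^bsub>free n\<^esub> e n (as @ y # bs))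
        \<in> tensor_relators k A n"
      using x y as bs n unfolding tensor_relators_def Let_def by (intro UnI1) (auto simp: append_tuples)
    then have "tensor n (as @ (x \<oplus>\<^bsub>A\<^esub> y) # bs)
        = tensor_kernel k A n +>\<^bsub>free n\<^esub> (e n (as @ x # bs) \<oplus>\<^bsub>free n\<^esub> e n (as @ y # bs))"
      using R x y unfolding tensor_def by (intro Q.coset_eqI ex M.a_closed A.a_closed) auto
    then show "tensor n (as @ (x \<oplus>\<^bsub>A\<^esub> y) # bs)
        = tensor n (as @ x # bs) \<oplus>\<^bsub>tensor_power k A n\<^esub> tensor n (as @ y # bs)"
      by (simp add: tensor_def tensor_power_def Q.quotient_add ex x y)
  }
  fix c assume c: "c \<in> carrier k"
  have "e n (as @ (c \<odot>\<^bsub>A\<^esub> x) # bs) \<ominus>\<^bsub>free n\<^esub> (c \<odot>\<^bsub>free n\<^esub> e n (as @ x # bs)) \<in> tensor_relators k A n"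
    using x c as bs n unfolding tensor_relators_def Let_def by (intro UnI2) (auto simp: append_tuples)
  then have "tensor n (as @ (c \<odot>\<^bsub>A\<^esub> x) # bs)
      = tensor_kernel k A n +>\<^bsub>free n\<^esub> (c \<odot>\<^bsub>free n\<^esub> e n (as @ x # bs))"
    using R x c unfolding tensor_def by (intro Q.coset_eqI ex M.smult_closed A.smult_closed) auto
  then show "tensor n (as @ (c \<odot>\<^bsub>A\<^esub> x) # bs) = c \<odot>\<^bsub>tensor_power k A n\<^esub> tensor n (as @ x # bs)"
    by (simp add: tensor_def tensor_power_def Q.quotient_smult ex x c)
qed

lemma multilinear_pure: "multilinear k A (sha_module k A) (pure k A)"
proof (rule multilinearI)
  fix as bs assume "set as \<subseteq> carrier A" "set bs \<subseteq> carrier A"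
  then have "linear_map k A (direct_sum {1..} (tensor_power k A))
      (\<lambda>x. single {1..} (tensor_power k A) (length as + length bs + 1)
        (tensor (length as + length bs + 1) (as @ x # bs)))"
    by (intro linear_map_comp[OF linear_map_tensor S.linear_map_single]) auto
  then show "linear_map k A (sha_module k A) (\<lambda>x. pure k A (as @ x # bs))"
    by (simp add: pure_tensor sha_module_def)
qed

lemma pure_closed:
  assumes "set as \<subseteq> carrier A" "as \<noteq> []"
  shows "pure k A as \<in> carrier (sha_module k A)"
  using multilinear_closed[OF multilinear_pure assms] .

text \<open>The pure tensors span \<open>Sha(A)\<close>: it is a direct sum of quotients of free modules, so this is
  induction over a direct sum twice, for the summands of \<open>Sha(A)\<close> and for the basis vectors of the
  free module above each of them.\<close>
lemma sha_induct [consumes 1, case_names pure add smult]: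
  assumes u: "u \<in> carrier (sha_module k A)"
    and pure: "\<And>as. as \<noteq> [] \<Longrightarrow> set as \<subseteq> carrier A \<Longrightarrow> P (pure k A as)"
    and add: "\<And>u v. u \<in> carrier (sha_module k A) \<Longrightarrow> v \<in> carrier (sha_module k A) \<Longrightarrow> P u \<Longrightarrow> P v
              \<Longrightarrow> P (u \<oplus>\<^bsub>sha_module k A\<^esub> v)"
    and smult: "\<And>c u. c \<in> carrier k \<Longrightarrow> u \<in> carrier (sha_module k A) \<Longrightarrow> P u
              \<Longrightarrow> P (c \<odot>\<^bsub>sha_module k A\<^esub> u)"
  shows "P u"
proof -
  interpret D: module k "sha_module k A" by (rule module_sha)
  have "pure k A [\<zero>\<^bsub>A\<^esub>] \<in> carrier (sha_module k A)" by (rule pure_closed) auto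
  \<comment> \<open>The zero vector is a multiple of any pure tensor.\<close>
  then have zero: "P \<zero>\<^bsub>sha_module k A\<^esub>"
    using smult[of "\<zero>\<^bsub>k\<^esub>", OF _ _ pure[of "[\<zero>\<^bsub>A\<^esub>]"]] by simp
  from u have "u \<in> carrier (direct_sum {1..} (tensor_power k A))" by (simp add: sha_module_def)
  then show ?thesis
  proof (induction rule: S.direct_sum_induct)
    case zero
    then show ?case using \<open>P \<zero>\<^bsub>sha_module k A\<^esub>\<close> by (simp add: sha_module_def)
  next
    case (add u v)
    then show ?case using assms(3)[of u v] by (simp add: sha_module_def)
  next
    case (single n m)
    \<comment> \<open>The canonical map from the free module on the \<open>n\<close>-tuples to the \<open>n\<close>-th summand of \<open>Sha(A)\<close>.\<close>
    define \<iota> where "\<iota> x = single {1..} (tensor_power k A) n (tensor_kernel k A n +>\<^bsub>free n\<^esub> x)" for x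
    have lin: "linear_map k (free n) (sha_module k A) \<iota>"
      unfolding \<iota>_def sha_module_def
      by (rule linear_map_comp[OF _ S.linear_map_single[OF single(1)]])
        (use Q.linear_map_coset in \<open>simp add: tensor_power_def\<close>)
    obtain x where x: "x \<in> carrier (free n)" "m = tensor_kernel k A n +>\<^bsub>free n\<^esub> x"
      using single(2) by (auto simp: tensor_power_def Q.carrier_quotient)
    from x(1) have "x \<in> carrier (direct_sum (tuples A n) (\<lambda>_. self_module k))" by (simp add: free_module_def)
    then have "P (\<iota> x)"
    proof (induction rule: F.direct_sum_induct)
      case zero
      show ?case using linear_map_zero[OF module_free module_sha lin] \<open>P \<zero>\<^bsub>sha_module k A\<^esub>\<close>
        by (simp add: free_module_def)
    next
      case (add x y)
      then show ?case
        using linear_map_add[OF lin, of x y] assms(3)[of "\<iota> x" "\<iota> y"] linear_map_closed[OF lin]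
        by (simp add: free_module_def)
    next
      case (single as c)
      have eq: "single (tuples A n) (\<lambda>_. self_module k) as c = c \<odot>\<^bsub>free n\<^esub> e n as"
        using single(2)
        by (auto simp: single_def basis_vec_def free_module_def direct_sum_smult fun_eq_iff)
      have as: "length as = n" "set as \<subseteq> carrier A" using single(1) by (auto simp: tuples_def)
      then have "as \<noteq> []" using \<open>n \<in> {1..}\<close> by auto
      have "\<iota> (e n as) = pure k A as" by (simp add: \<iota>_def pure_single as)
      then show ?case
        using single pure_closed[OF as(2) \<open>as \<noteq> []\<close>] pure[OF \<open>as \<noteq> []\<close> as(2)]
        by (simp add: eq linear_map_smult[OF lin] e_closed smult)
    qed
    then show ?case by (simp add: \<iota>_def x)
  qed
qed

text \<open>The uniqueness half of the universal property, and the way every identity between elements of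
  \<open>Sha(A)\<close> is reduced to pure tensors below.\<close>
lemma linear_maps_eqI:
  assumes f: "linear_map k (sha_module k A) M f" and g: "linear_map k (sha_module k A) M g"
    and eq: "\<And>as. as \<noteq> [] \<Longrightarrow> set as \<subseteq> carrier A \<Longrightarrow> f (pure k A as) = g (pure k A as)"
    and u: "u \<in> carrier (sha_module k A)"
  shows "f u = g u"
  using u by (induction rule: sha_induct) (simp_all add: eq linear_mapD[OF f] linear_mapD[OF g])

context
  fixes M :: "('k, 'b) module" and \<phi> :: "'a list \<Rightarrow> 'b"
  assumes M: "module k M" and \<phi>: "multilinear k A M \<phi>"
begin

interpretation M: module k M by (rule M)

abbreviation (input) "lin n \<equiv> direct_sum_lift (tuples A n) (\<lambda>_. self_module k) M (\<lambda>as c. c \<odot>\<^bsub>M\<^esub> \<phi> as)"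

lemma tensor_lift_alt: "tensor_lift k A M \<phi> n = (\<lambda>X. lin n (SOME x. x \<in> X))"
  by (simp add: tensor_lift_def direct_sum_lift_def Let_def fun_eq_iff)

lemma scaling_linear:
  assumes "n \<ge> 1" "as \<in> tuples A n"
  shows "linear_map k (self_module k) M (\<lambda>c. c \<odot>\<^bsub>M\<^esub> \<phi> as)"
proof -
  have "\<phi> as \<in> carrier M" using assms by (intro multilinear_closed[OF \<phi>]) (auto simp: tuples_def)
  then show ?thesis
    by (intro linear_mapI) (auto simp: M.smult_l_distr M.smult_assoc1)
qed

lemma linear_map_lin:
  assumes "n \<ge> 1"
  shows "linear_map k (free n) M (lin n)"
  using F.linear_map_direct_sum_lift[OF M scaling_linear[OF assms]] by (simp add: free_module_def)

lemma lin_e: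
  assumes "n \<ge> 1" "as \<in> tuples A n"
  shows "lin n (e n as) = \<phi> as"
proof -
  have "\<phi> as \<in> carrier M" using assms by (intro multilinear_closed[OF \<phi>]) (auto simp: tuples_def)
  then show ?thesis
    using F.direct_sum_lift_single[OF M scaling_linear[OF assms(1)] assms(2), where m = "\<one>\<^bsub>k\<^esub>"]
    by (simp add: basis_vec_single)
qed

text \<open>Multilinearity of \<open>\<phi>\<close> is what makes the relators vanish.\<close>
lemma lin_kernel:
  assumes n: "n \<ge> 1" and x: "x \<in> tensor_kernel k A n"
  shows "lin n x = \<zero>\<^bsub>M\<^esub>"
proof -
  interpret F': module k "free n" by (rule module_free)
  note lin = linear_map_lin[OF n]
  have "tensor_relators k A n \<subseteq> {x \<in> carrier (free n). lin n x = \<zero>\<^bsub>M\<^esub>}"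
  proof
    fix r assume r: "r \<in> tensor_relators k A n"
    have ex: "e n (as @ x # bs) \<in> carrier (free n)" "lin n (e n (as @ x # bs)) = \<phi> (as @ x # bs)"
      "\<phi> (as @ x # bs) \<in> carrier M"
      if "x \<in> carrier A" "set as \<subseteq> carrier A" "set bs \<subseteq> carrier A" "n = length as + length bs + 1" for as bs x
      using that n by (simp_all add: append_tuples e_closed lin_e multilinear_closed[OF \<phi>])
    from r consider
      as bs x y where "r = e n (as @ (x \<oplus>\<^bsub>A\<^esub> y) # bs) \<ominus>\<^bsub>free n\<^esub> (e n (as @ x # bs) \<oplus>\<^bsub>free n\<^esub> e n (as @ y # bs))"
        "as @ x # bs \<in> tuples A n" "y \<in> carrier A"
    | as bs x c where "r = e n (as @ (c \<odot>\<^bsub>A\<^esub> x) # bs) \<ominus>\<^bsub>free n\<^esub> (c \<odot>\<^bsub>free n\<^esub> e n (as @ x # bs))"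
        "as @ x # bs \<in> tuples A n" "c \<in> carrier k"
      unfolding tensor_relators_def Let_def by blast
    then have "lin n r = \<zero>\<^bsub>M\<^esub>"
    proof cases
      case 1
      then have d: "x \<in> carrier A" "y \<in> carrier A" "x \<oplus>\<^bsub>A\<^esub> y \<in> carrier A" "set as \<subseteq> carrier A" "set bs \<subseteq> carrier A"
        "n = length as + length bs + 1" by (auto simp: append_tuples)
      have "lin n r = \<phi> (as @ (x \<oplus>\<^bsub>A\<^esub> y) # bs) \<ominus>\<^bsub>M\<^esub> (\<phi> (as @ x # bs) \<oplus>\<^bsub>M\<^esub> \<phi> (as @ y # bs))"
        unfolding 1(1) using ex[OF _ d(4-6)] d(1-3)
        by (simp only: linear_map_minus[OF module_free M lin] linear_map_add[OF lin] F'.a_closed)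
      also have "\<dots> = \<zero>\<^bsub>M\<^esub>"
        using linear_map_add[OF multilinearD[OF \<phi> d(4,5)] d(1,2)] ex(3)[OF _ d(4-6)] d(1-2)
        by (simp add: M.r_neg a_minus_def)
      finally show ?thesis .
    next
      case 2
      then have d: "x \<in> carrier A" "c \<in> carrier k" "c \<odot>\<^bsub>A\<^esub> x \<in> carrier A" "set as \<subseteq> carrier A" "set bs \<subseteq> carrier A"
        "n = length as + length bs + 1" by (auto simp: append_tuples)
      have "lin n r = \<phi> (as @ (c \<odot>\<^bsub>A\<^esub> x) # bs) \<ominus>\<^bsub>M\<^esub> (c \<odot>\<^bsub>M\<^esub> \<phi> (as @ x # bs))"
        unfolding 2(1) using ex[OF _ d(4-6)] d(1-3)
        by (simp only: linear_map_minus[OF module_free M lin] linear_map_smult[OF lin] F'.smult_closed)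
      also have "\<dots> = \<zero>\<^bsub>M\<^esub>"
        using linear_map_smult[OF multilinearD[OF \<phi> d(4,5)] d(2,1)] ex(3)[OF _ d(4-6)] d(1-2)
        by (simp add: M.r_neg a_minus_def)
      finally show ?thesis .
    qed
    then show "r \<in> {x \<in> carrier (free n). lin n x = \<zero>\<^bsub>M\<^esub>}" using r relators_closed by auto
  qed
  then have "tensor_kernel k A n \<subseteq> {x \<in> carrier (free n). lin n x = \<zero>\<^bsub>M\<^esub>}"
    unfolding tensor_kernel_def
    by (rule submodule_gen_least[OF module_free relators_closed submodule_kernel[OF module_free M lin]])
  then show ?thesis using x by blast
qed

lemma linear_map_tensor_lift:
  assumes "n \<in> {1..}"
  shows "linear_map k (tensor_power k A n) M (tensor_lift k A M \<phi> n)"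
  using assms unfolding tensor_lift_alt tensor_power_def
  by (intro Q.linear_map_quotient_lift[OF M linear_map_lin lin_kernel]) auto

lemma tensor_lift_tensor:
  assumes "n \<ge> 1" "as \<in> tuples A n"
  shows "tensor_lift k A M \<phi> n (tensor n as) = \<phi> as"
  unfolding tensor_lift_alt tensor_def
  using Q.quotient_lift_coset[OF M linear_map_lin lin_kernel e_closed, of n as] assms by (simp add: lin_e)

lemma sha_lift_alt: "sha_lift k A M \<phi> = direct_sum_lift {1..} (tensor_power k A) M (tensor_lift k A M \<phi>)"
  by (simp add: sha_lift_def direct_sum_lift_def fun_eq_iff)

text \<open>The existence half of the universal property, assembled from the lifts to the single tensor
  powers.\<close>
theorem linear_map_sha_lift: "linear_map k (sha_module k A) M (sha_lift k A M \<phi>)"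
  unfolding sha_lift_alt sha_module_def by (rule S.linear_map_direct_sum_lift[OF M linear_map_tensor_lift])

theorem sha_lift_pure:
  assumes "as \<noteq> []" "set as \<subseteq> carrier A"
  shows "sha_lift k A M \<phi> (pure k A as) = \<phi> as"
proof -
  let ?n = "length as"
  have n: "?n \<in> {1..}" using assms by (cases as) auto
  have t: "as \<in> tuples A ?n" using assms by (simp add: tuples_def)
  have "tensor ?n as \<in> carrier (tensor_power k A ?n)"
    by (simp add: tensor_def tensor_power_def Q.carrier_quotient e_closed t)
  then show ?thesis
    unfolding sha_lift_alt pure_tensor
    using S.direct_sum_lift_single[OF M linear_map_tensor_lift n] n t by (simp add: tensor_lift_tensor)
qed

end

text \<open>If \<open>\<phi>\<close> depends linearly on a parameter, so does the map it induces: on a pure tensor this is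
  the hypothesis, and linearity in the parameter is stable under the linear combinations of pure
  tensors.  In this way one gets the linearity of \<open>a \<otimes> u\<close> in \<open>a\<close> and of the product in its second
  argument.\<close>
lemma linear_map_sha_lift_parameter:
  assumes B: "module k B" and M: "module k M"
    and \<phi>: "\<And>t. t \<in> carrier B \<Longrightarrow> multilinear k A M (\<phi> t)"
    and lin: "\<And>as. as \<noteq> [] \<Longrightarrow> set as \<subseteq> carrier A \<Longrightarrow> linear_map k B M (\<lambda>t. \<phi> t as)"
    and u: "u \<in> carrier (sha_module k A)"
  shows "linear_map k B M (\<lambda>t. sha_lift k A M (\<phi> t) u)"
  using u
proof (induction rule: sha_induct)
  case (pure as)
  then show ?case by (intro linear_map_cong[OF B lin]) (auto simp: sha_lift_pure[OF M \<phi>])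
next
  case (add u v)
  show ?case
    by (rule linear_map_cong[OF B linear_map_sum[OF M add(3,4)]])
      (simp add: linear_map_add[OF linear_map_sha_lift[OF M \<phi>]] add)
next
  case (smult c u)
  show ?case
    by (rule linear_map_cong[OF B linear_map_scale[OF M smult(3,1)]])
      (simp add: linear_map_smult[OF linear_map_sha_lift[OF M \<phi>]] smult)
qed

end

section \<open>Bilinearity of the product on \<open>Sha(A)\<close>\<close>

lemma Sha_sel [simp]:
  "carrier (Sha k l A) = carrier (sha_module k A)" "\<zero>\<^bsub>Sha k l A\<^esub> = \<zero>\<^bsub>sha_module k A\<^esub>"
  "x \<oplus>\<^bsub>Sha k l A\<^esub> y = x \<oplus>\<^bsub>sha_module k A\<^esub> y" "c \<odot>\<^bsub>Sha k l A\<^esub> x = c \<odot>\<^bsub>sha_module k A\<^esub> x"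
  "x \<otimes>\<^bsub>Sha k l A\<^esub> y = diamond k l A x y" "\<one>\<^bsub>Sha k l A\<^esub> = pure k A [\<one>\<^bsub>A\<^esub>]"
  by (simp_all add: Sha_def)

lemma linear_map_Sha [simp]:
  "linear_map k (Sha k l A) M f \<longleftrightarrow> linear_map k (sha_module k A) M f"
  "linear_map k M (Sha k l A) g \<longleftrightarrow> linear_map k M (sha_module k A) g"
  by (simp_all add: linear_map_def)

lemma multilinear_Sha [simp]:
  "multilinear k M (Sha k l A) \<phi> \<longleftrightarrow> multilinear k M (sha_module k A) \<phi>"
  by (simp add: multilinear_def)

lemma (in tensor_module) module_Sha: "module k (Sha k l A)"
  unfolding Sha_def by (rule module_record_update[OF module_sha])

text \<open>The induction that follows the recursion of \<open>\<diamond>\<close>.  The recursive calls put the unit in front of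
  one of the tails, which keeps the total length below that of the two lists; the new head is
  arbitrary here.\<close>
lemma nonempty_lists_induct [consumes 2, case_names left right both]:
  assumes "as \<noteq> []" "bs \<noteq> []"
    and left: "\<And>a b bs. P [a] (b # bs)"
    and right: "\<And>a as b. P (a # as) [b]"
    and both: "\<And>a b as bs. as \<noteq> [] \<Longrightarrow> bs \<noteq> [] \<Longrightarrow> (\<And>z. P as (z # bs)) \<Longrightarrow> (\<And>z. P (z # as) bs) \<Longrightarrow> P as bs
                \<Longrightarrow> P (a # as) (b # bs)"
  shows "P as bs"
  using assms(1,2)
proof (induction "length as + length bs" arbitrary: as bs rule: less_induct)
  case less
  obtain a as' b bs' where eq: "as = a # as'" "bs = b # bs'"
    using less.prems by (metis neq_Nil_conv)
  show ?case
  proof (cases "as' = [] \<or> bs' = []")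
    case True
    then show ?thesis using left right by (auto simp: eq)
  next
    case False
    then show ?thesis unfolding eq by (intro both less.hyps) (auto simp: eq)
  qed
qed

locale sha_algebra = tensor_module k A for k :: "'k ring" and A :: "('k, 'a) module" +
  fixes l :: 'k
  assumes algebra: "algebra k A" and l: "l \<in> carrier k"
begin

interpretation A: algebra k A by (rule algebra)
interpretation D: module k "sha_module k A" by (rule module_sha)

abbreviation "\<S> \<equiv> sha_module k A"

lemma multilinear_pure_Cons:
  assumes "a \<in> carrier A"
  shows "multilinear k A \<S> (\<lambda>as. pure k A (a # as))"
  using multilinearD[OF multilinear_pure, of "a # _"] assms by (intro multilinearI) simp

lemma linear_map_sha_cons:
  assumes "a \<in> carrier A"
  shows "linear_map k \<S> \<S> (sha_cons k A a)"
  unfolding sha_cons_def by (rule linear_map_sha_lift[OF module_sha multilinear_pure_Cons[OF assms]])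

lemma sha_cons_pure:
  assumes "a \<in> carrier A" "as \<noteq> []" "set as \<subseteq> carrier A"
  shows "sha_cons k A a (pure k A as) = pure k A (a # as)"
  unfolding sha_cons_def by (rule sha_lift_pure[OF module_sha multilinear_pure_Cons[OF assms(1)] assms(2,3)])

lemma linear_map_sha_cons_head:
  assumes "u \<in> carrier \<S>"
  shows "linear_map k A \<S> (\<lambda>a. sha_cons k A a u)"
  unfolding sha_cons_def
proof (rule linear_map_sha_lift_parameter[OF A module_sha multilinear_pure_Cons _ assms])
  fix as :: "'a list" assume "set as \<subseteq> carrier A"
  then show "linear_map k A \<S> (\<lambda>t. pure k A (t # as))"
    using multilinearD[OF multilinear_pure, of "[]" as] by simp
qed

lemma linear_map_mult_left: "y \<in> carrier A \<Longrightarrow> linear_map k A A (\<lambda>x. x \<otimes>\<^bsub>A\<^esub> y)"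
  by (intro linear_mapI) (auto simp: A.l_distr A.smult_assoc2)

abbreviation "pd \<equiv> pure_diamond k l A"

lemma pure_diamond_single_left: "pd [a] (b # bs) = pure k A ((a \<otimes>\<^bsub>A\<^esub> b) # bs)"
  by simp

lemma pure_diamond_single_right: "pd (a # as) [b] = pure k A ((a \<otimes>\<^bsub>A\<^esub> b) # as)"
  by (cases as) simp_all

lemma pure_diamond_Cons:
  assumes "as \<noteq> []" "bs \<noteq> []"
  shows "pd (a # as) (b # bs) = sha_cons k A (a \<otimes>\<^bsub>A\<^esub> b)
    (pd as (\<one>\<^bsub>A\<^esub> # bs) \<oplus>\<^bsub>\<S>\<^esub> pd (\<one>\<^bsub>A\<^esub> # as) bs \<oplus>\<^bsub>\<S>\<^esub> (l \<odot>\<^bsub>\<S>\<^esub> pd as bs))"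
  using assms by (cases as; cases bs) simp_all

lemmas pure_diamond_rules = pure_diamond_single_left pure_diamond_single_right pure_diamond_Cons

declare pure_diamond.simps [simp del]

lemma pure_diamond_closed:
  assumes "as \<noteq> []" "bs \<noteq> []" "set as \<subseteq> carrier A" "set bs \<subseteq> carrier A"
  shows "pd as bs \<in> carrier \<S>"
proof -
  have "\<forall>z \<in> carrier A. set as \<subseteq> carrier A \<longrightarrow> set bs \<subseteq> carrier A \<longrightarrow> pd as bs \<in> carrier \<S>"
    using assms(1,2)
  proof (induction as bs rule: nonempty_lists_induct)
    case (both a b as bs)
    have "pd as (\<one>\<^bsub>A\<^esub> # bs) \<in> carrier \<S>" "pd (\<one>\<^bsub>A\<^esub> # as) bs \<in> carrier \<S>" "pd as bs \<in> carrier \<S>"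
      if "set as \<subseteq> carrier A" "set bs \<subseteq> carrier A"
      using both(3)[of "\<one>\<^bsub>A\<^esub>"] both(4)[of "\<one>\<^bsub>A\<^esub>"] both(5) that by auto
    then show ?case by (auto simp: pure_diamond_Cons both(1,2) intro!: linear_map_closed[OF linear_map_sha_cons] l)
  qed (auto simp: pure_diamond_rules intro!: pure_closed)
  then show ?thesis using assms by auto
qed

text \<open>The recursion is symmetric in the two arguments.  Commutativity is used to transfer
  multilinearity from the first argument to the second.\<close>
lemma pure_diamond_commute:
  assumes "as \<noteq> []" "bs \<noteq> []" "set as \<subseteq> carrier A" "set bs \<subseteq> carrier A"
  shows "pd as bs = pd bs as"
proof -
  have "set as \<subseteq> carrier A \<longrightarrow> set bs \<subseteq> carrier A \<longrightarrow> pd as bs = pd bs as"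
    using assms(1,2)
  proof (induction as bs rule: nonempty_lists_induct)
    case (both a b as bs)
    show ?case
    proof (intro impI)
      assume "set (a # as) \<subseteq> carrier A" "set (b # bs) \<subseteq> carrier A"
      then have c: "a \<in> carrier A" "b \<in> carrier A" "set as \<subseteq> carrier A" "set bs \<subseteq> carrier A" by auto
      have eqs: "pd as (\<one>\<^bsub>A\<^esub> # bs) = pd (\<one>\<^bsub>A\<^esub> # bs) as" "pd (\<one>\<^bsub>A\<^esub> # as) bs = pd bs (\<one>\<^bsub>A\<^esub> # as)" "pd as bs = pd bs as"
        using both(3)[of "\<one>\<^bsub>A\<^esub>"] both(4)[of "\<one>\<^bsub>A\<^esub>"] both(5) c by auto
      have cl: "pd (\<one>\<^bsub>A\<^esub> # bs) as \<in> carrier \<S>" "pd bs (\<one>\<^bsub>A\<^esub> # as) \<in> carrier \<S>"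
        using c both(1,2) by (auto intro!: pure_diamond_closed)
      show "pd (a # as) (b # bs) = pd (b # bs) (a # as)"
        unfolding pure_diamond_Cons[OF both(1,2)] pure_diamond_Cons[OF both(2,1)] eqs
        using c cl by (simp add: A.m_comm D.a_comm)
    qed
  qed (auto simp: pure_diamond_rules A.m_comm)
  then show ?thesis using assms by auto
qed

text \<open>The varied slot is either the head, where linearity comes from the product of \<open>A\<close> and from
  \<open>linear_map_sha_cons_head\<close>, or it lies in the tail, where it occurs in the three recursive calls
  and the induction hypotheses apply.  The induction therefore has to range over all
  decompositions of the first list.\<close>
lemma pure_diamond_linear_left:
  assumes "bs \<noteq> []" "set bs \<subseteq> carrier A" "set xs \<subseteq> carrier A" "set ys \<subseteq> carrier A"
  shows "linear_map k A \<S> (\<lambda>x. pd (xs @ x # ys) bs)"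
proof -
  have "\<forall>xs y ys. as = xs @ y # ys \<longrightarrow> set xs \<subseteq> carrier A \<longrightarrow> set ys \<subseteq> carrier A \<longrightarrow> set bs \<subseteq> carrier A
      \<longrightarrow> linear_map k A \<S> (\<lambda>x. pd (xs @ x # ys) bs)" if "as \<noteq> []" "bs \<noteq> []" for as bs
    using that
  proof (induction as bs rule: nonempty_lists_induct)
    case (left a b bs)
    have "linear_map k A \<S> (\<lambda>x. pure k A ((x \<otimes>\<^bsub>A\<^esub> b) # bs))" if "set (b # bs) \<subseteq> carrier A"
      using linear_map_comp[OF linear_map_mult_left multilinearD[OF multilinear_pure, of "[]" bs], of b] that by simp
    then show ?case by (auto simp: Cons_eq_append_conv pure_diamond_rules)
  next
    case (right a as b)
    have "linear_map k A \<S> (\<lambda>x. pure k A ((x \<otimes>\<^bsub>A\<^esub> b) # as))" if "b \<in> carrier A" "set as \<subseteq> carrier A"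
      using linear_map_comp[OF linear_map_mult_left multilinearD[OF multilinear_pure, of "[]" as], of b] that by simp
    moreover have "linear_map k A \<S> (\<lambda>x. pure k A ((a \<otimes>\<^bsub>A\<^esub> b) # xs @ x # ys))"
      if "a \<in> carrier A" "b \<in> carrier A" "set xs \<subseteq> carrier A" "set ys \<subseteq> carrier A" for xs ys
      using multilinearD[OF multilinear_pure, of "(a \<otimes>\<^bsub>A\<^esub> b) # xs" ys] that by simp
    ultimately show ?case by (auto simp: Cons_eq_append_conv pure_diamond_rules)
  next
    case (both a b as bs)
    have cl: "pd as (\<one>\<^bsub>A\<^esub> # bs) \<in> carrier \<S>" "pd (\<one>\<^bsub>A\<^esub> # as) bs \<in> carrier \<S>" "pd as bs \<in> carrier \<S>"
      if "set as \<subseteq> carrier A" "set bs \<subseteq> carrier A"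
      using that both(1,2) by (auto intro!: pure_diamond_closed)
    have "linear_map k A \<S> (\<lambda>x. pd (x # as) (b # bs))" if "set as \<subseteq> carrier A" "set (b # bs) \<subseteq> carrier A"
      unfolding pure_diamond_Cons[OF both(1,2)]
      by (rule linear_map_comp[OF linear_map_mult_left linear_map_sha_cons_head])
        (use that l cl in auto)
    moreover have "linear_map k A \<S> (\<lambda>x. pd (a # xs @ x # ys) (b # bs))"
      if as: "as = xs @ y # ys"
        and c: "a \<in> carrier A" "set xs \<subseteq> carrier A" "set ys \<subseteq> carrier A" "set (b # bs) \<subseteq> carrier A"
      for xs y ys
    proof -
      have 1: "linear_map k A \<S> (\<lambda>x. pd (xs @ x # ys) (\<one>\<^bsub>A\<^esub> # bs))"
        using both(3)[of "\<one>\<^bsub>A\<^esub>", rule_format, OF as] c by simp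
      have 2: "linear_map k A \<S> (\<lambda>x. pd (\<one>\<^bsub>A\<^esub> # xs @ x # ys) bs)"
        using both(4)[of "\<one>\<^bsub>A\<^esub>", rule_format, of "\<one>\<^bsub>A\<^esub> # xs" y ys] as c by simp
      have 3: "linear_map k A \<S> (\<lambda>x. pd (xs @ x # ys) bs)"
        using both(5)[rule_format, OF as] c by simp
      have ne: "xs @ x # ys \<noteq> []" for x by simp
      show ?thesis
        unfolding pure_diamond_Cons[OF ne both(2)]
        using c by (intro linear_map_comp[OF _ linear_map_sha_cons] linear_map_sum linear_map_scale module_sha 1 2 3 l) auto
    qed
    ultimately show ?case by (auto simp: Cons_eq_append_conv)
  qed
  \<comment> \<open>Any entry may stand in the slot that is varied.\<close>
  from this[of "xs @ undefined # ys" bs] show ?thesis using assms by blast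
qed

lemma multilinear_pure_diamond:
  assumes "as \<noteq> []" "set as \<subseteq> carrier A"
  shows "multilinear k A \<S> (\<lambda>bs. pd bs as)" "multilinear k A \<S> (\<lambda>bs. pd as bs)"
proof -
  show "multilinear k A \<S> (\<lambda>bs. pd bs as)"
    using assms by (intro multilinearI pure_diamond_linear_left)
  then have *: "linear_map k A \<S> (\<lambda>x. pd (xs @ x # ys) as)" if "set xs \<subseteq> carrier A" "set ys \<subseteq> carrier A" for xs ys
    using that by (rule multilinearD)
  show "multilinear k A \<S> (\<lambda>bs. pd as bs)"
  proof (rule multilinearI)
    fix xs ys assume c: "set xs \<subseteq> carrier A" "set ys \<subseteq> carrier A"
    show "linear_map k A \<S> (\<lambda>x. pd as (xs @ x # ys))"
      by (rule linear_map_cong[OF A *[OF c]]) (use assms c in \<open>auto intro!: pure_diamond_commute\<close>)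
  qed
qed

abbreviation "diam \<equiv> diamond k l A"

lemma pure_diamond_lift_linear:
  assumes "v \<in> carrier \<S>"
  shows "multilinear k A \<S> (\<lambda>as. sha_lift k A \<S> (pd as) v)"
proof (rule multilinearI)
  fix xs ys assume c: "set xs \<subseteq> carrier A" "set ys \<subseteq> carrier A"
  show "linear_map k A \<S> (\<lambda>x. sha_lift k A \<S> (pd (xs @ x # ys)) v)"
    using c by (intro linear_map_sha_lift_parameter[OF A module_sha] multilinear_pure_diamond(2)
        pure_diamond_linear_left assms) auto
qed

text \<open>Bilinearity of the product.  In the first argument it is the linearity of a lift, in the second
  the linear dependence of a lift on a parameter.\<close>
lemma diamond_linear_left:
  assumes "v \<in> carrier \<S>"
  shows "linear_map k \<S> \<S> (\<lambda>u. diam u v)"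
  unfolding diamond_def by (rule linear_map_sha_lift[OF module_sha pure_diamond_lift_linear[OF assms]])

lemma diamond_linear_right:
  assumes "u \<in> carrier \<S>"
  shows "linear_map k \<S> \<S> (\<lambda>v. diam u v)"
  unfolding diamond_def
  by (rule linear_map_sha_lift_parameter[OF module_sha module_sha pure_diamond_lift_linear _ assms])
    (auto intro: linear_map_sha_lift[OF module_sha] multilinear_pure_diamond(2))

lemma diamond_pure:
  assumes "as \<noteq> []" "set as \<subseteq> carrier A" "bs \<noteq> []" "set bs \<subseteq> carrier A"
  shows "diam (pure k A as) (pure k A bs) = pd as bs"
  unfolding diamond_def
  using assms
  by (simp add: sha_lift_pure[OF module_sha pure_diamond_lift_linear] pure_closed
      sha_lift_pure[OF module_sha multilinear_pure_diamond(2)])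

lemma diamond_one_left:
  assumes "u \<in> carrier \<S>"
  shows "diam (pure k A [\<one>\<^bsub>A\<^esub>]) u = u"
proof (rule linear_maps_eqI[OF diamond_linear_right linear_map_id _ assms])
  fix as :: "'a list" assume as: "as \<noteq> []" "set as \<subseteq> carrier A"
  then obtain b bs where "as = b # bs" by (cases as) auto
  then show "diam (pure k A [\<one>\<^bsub>A\<^esub>]) (pure k A as) = pure k A as"
    using as by (simp add: diamond_pure pure_diamond_single_left)
qed (simp add: pure_closed)

lemma sha_P_eq: "u \<in> carrier \<S> \<Longrightarrow> sha_P k l A u = sha_cons k A \<one>\<^bsub>A\<^esub> u"
  by (simp add: sha_P_def)

lemma linear_map_sha_P: "linear_map k \<S> \<S> (sha_P k l A)"
  by (rule linear_map_cong[OF module_sha linear_map_sha_cons]) (auto simp: sha_P_eq)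

end

section \<open>Algebra homomorphisms and the action of T on them\<close>

lemma alg_homD:
  assumes "f \<in> alg_hom k A B"
  shows alg_hom_linear: "linear_map k A B f"
    and alg_hom_mult: "\<And>x y. x \<in> carrier A \<Longrightarrow> y \<in> carrier A \<Longrightarrow> f (x \<otimes>\<^bsub>A\<^esub> y) = f x \<otimes>\<^bsub>B\<^esub> f y"
    and alg_hom_one: "f \<one>\<^bsub>A\<^esub> = \<one>\<^bsub>B\<^esub>"
    and alg_hom_ext: "f \<in> extensional (carrier A)"
  using assms by (auto simp: alg_hom_def ring_hom_def linear_map_def)

lemma alg_homI:
  assumes "linear_map k A B f"
    and "\<And>x y. x \<in> carrier A \<Longrightarrow> y \<in> carrier A \<Longrightarrow> f (x \<otimes>\<^bsub>A\<^esub> y) = f x \<otimes>\<^bsub>B\<^esub> f y"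
    and "f \<one>\<^bsub>A\<^esub> = \<one>\<^bsub>B\<^esub>" and "f \<in> extensional (carrier A)"
  shows "f \<in> alg_hom k A B"
  using assms by (auto simp: alg_hom_def ring_hom_def linear_map_def)

context tensor_module
begin

context
  fixes B :: "('k, 'b) module" and f :: "'a \<Rightarrow> 'b" and l :: 'k
  assumes B: "module k B" and f: "linear_map k A B f"
begin

interpretation B: tensor_module k B by (rule tensor_module.intro) (rule B)

lemma map_closed: "set as \<subseteq> carrier A \<Longrightarrow> set (map f as) \<subseteq> carrier B"
  using linear_map_closed[OF f] by auto

lemma multilinear_pure_map: "multilinear k A (Sha k l B) (\<lambda>as. pure k B (map f as))"
proof (rule multilinearI)
  fix xs ys assume "set xs \<subseteq> carrier A" "set ys \<subseteq> carrier A"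
  from linear_map_comp[OF f multilinearD[OF B.multilinear_pure map_closed[OF this(1)] map_closed[OF this(2)]]]
  show "linear_map k A (Sha k l B) (\<lambda>x. pure k B (map f (xs @ x # ys)))" by simp
qed

lemma linear_map_T_map: "linear_map k (sha_module k A) (sha_module k B) (T_map k l A B f)"
  using linear_map_cong[OF module_sha linear_map_sha_lift[OF B.module_Sha multilinear_pure_map]]
  by (simp add: T_map_def)

lemma T_map_pure:
  assumes "as \<noteq> []" "set as \<subseteq> carrier A"
  shows "T_map k l A B f (pure k A as) = pure k B (map f as)"
  using assms by (simp add: T_map_def pure_closed sha_lift_pure[OF B.module_Sha multilinear_pure_map])

end

end

section \<open>The counit of a Rota-Baxter algebra\<close>

lemma nested_P_Cons:
  assumes "as \<noteq> []"
  shows "nested_P X (a # as) = a \<otimes>\<^bsub>fst X\<^esub> snd X (nested_P X as)"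
  using assms by (cases as) simp_all

lemma nested_P_closed:
  assumes "\<And>x y. x \<in> carrier B \<Longrightarrow> y \<in> carrier B \<Longrightarrow> x \<otimes>\<^bsub>B\<^esub> y \<in> carrier B"
    and "\<And>x. x \<in> carrier B \<Longrightarrow> Q x \<in> carrier B"
    and "as \<noteq> []" "set as \<subseteq> carrier B"
  shows "nested_P (B, Q) as \<in> carrier B"
  using assms(3,4)
proof (induction as)
  case (Cons a as)
  then show ?case using assms(1,2) by (cases "as = []") (simp_all add: nested_P_Cons)
qed simp

text \<open>Stated for any bilinear product and linear operator because it is applied both to a Rota-Baxter
  algebra, for the counit, and to \<open>Sha(A)\<close>, for the multiplication of the monad.\<close>
lemma multilinear_nested_P:
  assumes left: "\<And>y. y \<in> carrier B \<Longrightarrow> linear_map k B B (\<lambda>x. x \<otimes>\<^bsub>B\<^esub> y)"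
    and right: "\<And>x. x \<in> carrier B \<Longrightarrow> linear_map k B B (\<lambda>y. x \<otimes>\<^bsub>B\<^esub> y)"
    and Q: "linear_map k B B Q"
  shows "multilinear k B B (nested_P (B, Q))"
proof (rule multilinearI)
  fix as bs assume "set as \<subseteq> carrier B" and bs: "set bs \<subseteq> carrier B"
  then show "linear_map k B B (\<lambda>x. nested_P (B, Q) (as @ x # bs))"
  proof (induction as)
    case Nil
    show ?case
    proof (cases "bs = []")
      case False
      have "Q (nested_P (B, Q) bs) \<in> carrier B"
        using nested_P_closed[of B Q bs] linear_map_closed[OF Q] linear_map_closed[OF left] False bs by blast
      then show ?thesis using left False by (simp add: nested_P_Cons)
    qed (simp add: linear_map_id)
  next
    case (Cons a as)
    then have "linear_map k B B (\<lambda>x. a \<otimes>\<^bsub>B\<^esub> Q (nested_P (B, Q) (as @ x # bs)))"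
      by (intro linear_map_comp[OF linear_map_comp[OF _ Q] right]) auto
    then show ?case by (simp add: nested_P_Cons)
  qed
qed

context sha_algebra
begin

interpretation A: algebra k A by (rule algebra)
interpretation D: module k "sha_module k A" by (rule module_sha)
interpretation T: tensor_module k "Sha k l A" by (rule tensor_module.intro) (rule module_Sha)

lemma linear_map_mult_right: "x \<in> carrier A \<Longrightarrow> linear_map k A A (\<lambda>y. x \<otimes>\<^bsub>A\<^esub> y)"
  by (rule linear_map_cong[OF A linear_map_mult_left[of x]]) (simp_all add: A.m_comm)

lemma multilinear_nested_free_rb: "multilinear k (Sha k l A) \<S> (nested_P (free_rb k l A))"
  using multilinear_nested_P[of "Sha k l A" k "sha_P k l A"]
  by (simp add: free_rb_def diamond_linear_left diamond_linear_right linear_map_sha_P)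

lemma nested_free_rb_closed:
  "us \<noteq> [] \<Longrightarrow> set us \<subseteq> carrier \<S> \<Longrightarrow> nested_P (free_rb k l A) us \<in> carrier \<S>"
  using multilinear_closed[OF multilinear_nested_free_rb] by simp

lemma linear_map_mu: "linear_map k (sha_module k (Sha k l A)) \<S> (mult_mu k l A)"
proof -
  have "multilinear k (Sha k l A) (Sha k l A) (nested_P (free_rb k l A))"
    using multilinear_nested_free_rb by simp
  from linear_map_cong[OF T.module_sha T.linear_map_sha_lift[OF module_Sha this]]
  show ?thesis by (simp add: mult_mu_def counit_eps_def free_rb_def)
qed

lemma mu_pure:
  assumes "us \<noteq> []" "set us \<subseteq> carrier \<S>"
  shows "mult_mu k l A (pure k (Sha k l A) us) = nested_P (free_rb k l A) us"
proof -
  have "multilinear k (Sha k l A) (Sha k l A) (nested_P (free_rb k l A))"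
    using multilinear_nested_free_rb by simp
  from T.sha_lift_pure[OF module_Sha this assms(1)] assms
  show ?thesis by (simp add: mult_mu_def counit_eps_def free_rb_def T.pure_closed)
qed

text \<open>Both sides of the associativity law are linear maps on \<open>Sha(Sha(A))\<close>, so the law amounts to
  its instances at pure tensors of elements of \<open>Sha(A)\<close>.  In this form \<open>Sha(Sha(A))\<close> itself
  disappears from the law.\<close>
lemma T_algebra_iff:
  "is_T_algebra k l (A, h) \<longleftrightarrow>
    h \<in> alg_hom k (Sha k l A) A \<and> (\<forall>a\<in>carrier A. h (pure k A [a]) = a) \<and>
    (\<forall>us. us \<noteq> [] \<longrightarrow> set us \<subseteq> carrier \<S> \<longrightarrow>
      h (pure k A (map h us)) = h (nested_P (free_rb k l A) us))"
proof -
  have "(\<forall>U\<in>carrier (Sha k l (Sha k l A)). h (T_map k l (Sha k l A) A h U) = h (mult_mu k l A U)) \<longleftrightarrow>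
    (\<forall>us. us \<noteq> [] \<longrightarrow> set us \<subseteq> carrier \<S> \<longrightarrow> h (pure k A (map h us)) = h (nested_P (free_rb k l A) us))"
    (is "?L \<longleftrightarrow> ?R")
    if h: "h \<in> alg_hom k (Sha k l A) A"
  proof -
    note lin = alg_hom_linear[OF h]
    have lin': "linear_map k \<S> A h" using lin by simp
    have pure: "T_map k l (Sha k l A) A h (pure k (Sha k l A) us) = pure k A (map h us)"
      "pure k (Sha k l A) us \<in> carrier (sha_module k (Sha k l A))"
      if "us \<noteq> []" "set us \<subseteq> carrier \<S>" for us
      using T.T_map_pure[OF A lin that(1)] T.pure_closed[of us] that by auto
    show ?thesis
    proof
      assume L: ?L
      then show ?R using pure mu_pure by fastforce
    next
      assume R: ?R
      show ?L
      proof
        fix U assume "U \<in> carrier (Sha k l (Sha k l A))"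
        then have U: "U \<in> carrier (sha_module k (Sha k l A))" by simp
        show "h (T_map k l (Sha k l A) A h U) = h (mult_mu k l A U)"
          by (rule T.linear_maps_eqI[OF linear_map_comp[OF T.linear_map_T_map[OF A lin] lin']
                linear_map_comp[OF linear_map_mu lin'] _ U])
            (use R pure mu_pure in auto)
      qed
    qed
  qed
  then show ?thesis unfolding is_T_algebra_def by (auto simp: unit_eta_def algebra)
qed

end

locale rb_algebra = sha_algebra k A l for k :: "'k ring" and A :: "('k, 'a) module" and l :: 'k +
  fixes P :: "'a \<Rightarrow> 'a"
  assumes rb: "rota_baxter_operator k l A P"
begin

interpretation A: algebra k A by (rule algebra)
interpretation D: module k "sha_module k A" by (rule module_sha)

lemma P_linear: "linear_map k A A P" and P_ext: "P \<in> extensional (carrier A)"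
  using rb by (auto simp: rota_baxter_operator_def linear_endo_def linear_map_def PiE_def)

lemma P_mult:
  assumes "x \<in> carrier A" "y \<in> carrier A"
  shows "P x \<otimes>\<^bsub>A\<^esub> P y = P (x \<otimes>\<^bsub>A\<^esub> P y \<oplus>\<^bsub>A\<^esub> y \<otimes>\<^bsub>A\<^esub> P x \<oplus>\<^bsub>A\<^esub> l \<odot>\<^bsub>A\<^esub> (x \<otimes>\<^bsub>A\<^esub> y))"
  using assms rb l
  by (simp add: rota_baxter_operator_def linear_mapD[OF P_linear])

abbreviation "nested \<equiv> nested_P (A, P)"
abbreviation "eps \<equiv> counit_eps k l (A, P)"

lemma multilinear_nested: "multilinear k A A nested"
  by (intro multilinear_nested_P linear_map_mult_left linear_map_mult_right P_linear)

lemma nested_closed: "as \<noteq> [] \<Longrightarrow> set as \<subseteq> carrier A \<Longrightarrow> nested as \<in> carrier A"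
  by (rule multilinear_closed[OF multilinear_nested])

lemma nested_Cons: "as \<noteq> [] \<Longrightarrow> nested (a # as) = a \<otimes>\<^bsub>A\<^esub> P (nested as)"
  by (simp add: nested_P_Cons)

lemma eps_linear: "linear_map k \<S> A eps"
  using linear_map_cong[OF module_sha linear_map_sha_lift[OF A multilinear_nested]]
  by (simp add: counit_eps_def)

lemmas eps_closed = linear_map_closed[OF eps_linear]

lemma eps_pure:
  assumes "as \<noteq> []" "set as \<subseteq> carrier A"
  shows "eps (pure k A as) = nested as"
  using assms by (simp add: counit_eps_def pure_closed sha_lift_pure[OF A multilinear_nested])

lemma eps_sha_cons:
  assumes a: "a \<in> carrier A" and u: "u \<in> carrier \<S>"
  shows "eps (sha_cons k A a u) = a \<otimes>\<^bsub>A\<^esub> P (eps u)"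
proof (rule linear_maps_eqI[OF _ _ _ u])
  show "linear_map k \<S> A (\<lambda>u. eps (sha_cons k A a u))"
    by (rule linear_map_comp[OF linear_map_sha_cons[OF a] eps_linear])
  show "linear_map k \<S> A (\<lambda>u. a \<otimes>\<^bsub>A\<^esub> P (eps u))"
    by (rule linear_map_comp[OF linear_map_comp[OF eps_linear P_linear] linear_map_mult_right[OF a]])
qed (simp add: a sha_cons_pure eps_pure nested_Cons)

text \<open>The recursion of \<open>\<diamond>\<close> is the Rota-Baxter identity in disguise.  With \<open>x\<close> and \<open>y\<close> the values at
  the two tails, the three summands in the recursion have the values \<open>x P(y)\<close>, \<open>y P(x)\<close>
  and \<open>\<lambda> x y\<close>; applying \<open>P\<close> to their sum gives \<open>P(x) P(y)\<close>.\<close>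
lemma eps_pure_diamond:
  assumes "as \<noteq> []" "bs \<noteq> []" "set as \<subseteq> carrier A" "set bs \<subseteq> carrier A"
  shows "eps (pd as bs) = nested as \<otimes>\<^bsub>A\<^esub> nested bs"
proof -
  note [simp] = linear_map_closed[OF P_linear]
  have "set as \<subseteq> carrier A \<longrightarrow> set bs \<subseteq> carrier A \<longrightarrow> eps (pd as bs) = nested as \<otimes>\<^bsub>A\<^esub> nested bs"
    using assms(1,2)
  proof (induction as bs rule: nonempty_lists_induct)
    case (left a b bs)
    show ?case
      by (cases "bs = []") (auto simp: pure_diamond_rules eps_pure nested_Cons nested_closed A.m_assoc)
  next
    case (right a as b)
    show ?case
      by (cases "as = []") (auto simp: pure_diamond_rules eps_pure nested_Cons nested_closed A.m_ac)
  next
    case (both a b as bs)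
    show ?case
    proof (intro impI)
      assume "set (a # as) \<subseteq> carrier A" "set (b # bs) \<subseteq> carrier A"
      then have c: "a \<in> carrier A" "b \<in> carrier A" "set as \<subseteq> carrier A" "set bs \<subseteq> carrier A" by auto
      define x y where "x = nested as" and "y = nested bs"
      have xy: "x \<in> carrier A" "y \<in> carrier A" using nested_closed both(1,2) c by (auto simp: x_def y_def)
      have cl: "pd as (\<one>\<^bsub>A\<^esub> # bs) \<in> carrier \<S>" "pd (\<one>\<^bsub>A\<^esub> # as) bs \<in> carrier \<S>" "pd as bs \<in> carrier \<S>"
        using c both(1,2) by (auto intro!: pure_diamond_closed)
      have IH: "eps (pd as (\<one>\<^bsub>A\<^esub> # bs)) = x \<otimes>\<^bsub>A\<^esub> P y" "eps (pd (\<one>\<^bsub>A\<^esub> # as) bs) = y \<otimes>\<^bsub>A\<^esub> P x"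
        "eps (pd as bs) = x \<otimes>\<^bsub>A\<^esub> y"
        using both(3)[of "\<one>\<^bsub>A\<^esub>"] both(4)[of "\<one>\<^bsub>A\<^esub>"] both(1,2,5) c xy
        by (auto simp: x_def y_def nested_Cons A.m_comm)
      have "eps (pd (a # as) (b # bs)) = (a \<otimes>\<^bsub>A\<^esub> b) \<otimes>\<^bsub>A\<^esub> (P x \<otimes>\<^bsub>A\<^esub> P y)"
        unfolding pure_diamond_Cons[OF both(1,2)] P_mult[OF xy] using c cl l
        by (simp add: eps_sha_cons linear_mapD[OF eps_linear] IH)
      also have "\<dots> = nested (a # as) \<otimes>\<^bsub>A\<^esub> nested (b # bs)"
        using both(1,2) c xy by (simp add: nested_Cons A.m_ac flip: x_def y_def)
      finally show "eps (pd (a # as) (b # bs)) = nested (a # as) \<otimes>\<^bsub>A\<^esub> nested (b # bs)" .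
    qed
  qed
  then show ?thesis using assms by auto
qed

lemma eps_diamond:
  assumes u: "u \<in> carrier \<S>" and v: "v \<in> carrier \<S>"
  shows "eps (diam u v) = eps u \<otimes>\<^bsub>A\<^esub> eps v"
proof (rule linear_maps_eqI[OF _ _ _ u])
  show "linear_map k \<S> A (\<lambda>u. eps (diam u v))"
    by (rule linear_map_comp[OF diamond_linear_left[OF v] eps_linear])
  show "linear_map k \<S> A (\<lambda>u. eps u \<otimes>\<^bsub>A\<^esub> eps v)"
    by (rule linear_map_comp[OF eps_linear linear_map_mult_left[OF eps_closed[OF v]]])
  fix as :: "'a list" assume as: "as \<noteq> []" "set as \<subseteq> carrier A"
  show "eps (diam (pure k A as) v) = eps (pure k A as) \<otimes>\<^bsub>A\<^esub> eps v"
  proof (rule linear_maps_eqI[OF _ _ _ v])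
    \<comment> \<open>Both sides are linear in \<open>v\<close> as well, which leaves a pair of pure tensors.\<close>
    show "linear_map k \<S> A (\<lambda>v. eps (diam (pure k A as) v))"
      by (rule linear_map_comp[OF diamond_linear_right[OF pure_closed[OF as(2,1)]] eps_linear])
    show "linear_map k \<S> A (\<lambda>v. eps (pure k A as) \<otimes>\<^bsub>A\<^esub> eps v)"
      by (rule linear_map_comp[OF eps_linear linear_map_mult_right[OF eps_closed[OF pure_closed[OF as(2,1)]]]])
  qed (simp add: as diamond_pure eps_pure_diamond eps_pure)
qed

lemma eps_alg_hom: "eps \<in> alg_hom k (Sha k l A) A"
proof (rule alg_homI)
  show "eps \<in> extensional (carrier (Sha k l A))" by (simp add: counit_eps_def)
qed (simp_all add: eps_linear eps_diamond eps_pure)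

text \<open>The counit turns \<open>\<diamond>\<close> into the product and \<open>P\<^sub>A\<close> into \<open>P\<close>, hence nested
  expressions into nested expressions.  This is the associativity law at a pure tensor.\<close>
lemma eps_nested:
  assumes "us \<noteq> []" "set us \<subseteq> carrier \<S>"
  shows "eps (nested_P (free_rb k l A) us) = nested (map eps us)"
  using assms
proof (induction us)
  case (Cons u us)
  show ?case
  proof (cases "us = []")
    case False
    then have n: "nested_P (free_rb k l A) us \<in> carrier \<S>" using Cons.prems by (intro nested_free_rb_closed) auto
    \<comment> \<open>The factor \<open>1\<close> is the head of \<open>P\<^sub>A(w) = 1 \<otimes> w\<close>.\<close>
    have "eps (nested_P (free_rb k l A) (u # us)) = eps u \<otimes>\<^bsub>A\<^esub> (\<one>\<^bsub>A\<^esub> \<otimes>\<^bsub>A\<^esub> P (eps (nested_P (free_rb k l A) us)))"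
      using False Cons.prems n linear_map_closed[OF linear_map_sha_P n]
      by (simp add: nested_P_Cons free_rb_def eps_diamond sha_P_eq eps_sha_cons)
    then show ?thesis
      using False Cons n linear_map_closed[OF P_linear eps_closed[OF n]] by (simp add: nested_Cons)
  qed (simp add: free_rb_def)
qed simp

theorem counit_T_algebra: "is_T_algebra k l (A, eps)"
  unfolding T_algebra_iff
proof (intro conjI allI impI ballI eps_alg_hom)
  fix us assume us: "us \<noteq> []" "set us \<subseteq> carrier \<S>"
  then have "set (map eps us) \<subseteq> carrier A" using eps_closed by auto
  then show "eps (pure k A (map eps us)) = eps (nested_P (free_rb k l A) us)"
    using us by (simp add: eps_pure eps_nested)
qed (simp add: eps_pure)

lemma P_from_counit:
  assumes "a \<in> carrier A"
  shows "eps (pure k A [\<one>\<^bsub>A\<^esub>, a]) = P a"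
  using assms linear_map_closed[OF P_linear] by (simp add: eps_pure)

end

section \<open>The Rota-Baxter operator of a T-algebra\<close>

text \<open>Applied to the counit of \<open>(A, P)\<close> this returns \<open>P\<close>, since the value of the counit at
  \<open>1 \<otimes> a\<close> is \<open>1 P(a)\<close>.\<close>
definition operator_of :: "'k ring \<Rightarrow> ('k, 'a) module \<Rightarrow> (('k, 'a) sha \<Rightarrow> 'a) \<Rightarrow> 'a \<Rightarrow> 'a" where
  "operator_of k A h = (\<lambda>a\<in>carrier A. h (pure k A [\<one>\<^bsub>A\<^esub>, a]))"

locale T_algebra = sha_algebra k A l for k :: "'k ring" and A :: "('k, 'a) module" and l :: 'k +
  fixes h :: "('k, 'a) sha \<Rightarrow> 'a"
  assumes T: "is_T_algebra k l (A, h)"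
begin

interpretation A: algebra k A by (rule algebra)
interpretation D: module k "sha_module k A" by (rule module_sha)

abbreviation "P \<equiv> operator_of k A h"

lemma h_alg_hom: "h \<in> alg_hom k (Sha k l A) A"
  and h_unit: "a \<in> carrier A \<Longrightarrow> h (pure k A [a]) = a"
  and h_assoc: "us \<noteq> [] \<Longrightarrow> set us \<subseteq> carrier \<S> \<Longrightarrow> h (pure k A (map h us)) = h (nested_P (free_rb k l A) us)"
  using T unfolding T_algebra_iff by blast+

lemma h_linear: "linear_map k \<S> A h"
  using alg_hom_linear[OF h_alg_hom] by simp

lemmas h_closed = linear_map_closed[OF h_linear]

lemma h_mult: "u \<in> carrier \<S> \<Longrightarrow> v \<in> carrier \<S> \<Longrightarrow> h (diam u v) = h u \<otimes>\<^bsub>A\<^esub> h v"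
  using alg_hom_mult[OF h_alg_hom] by simp

lemma P_linear: "linear_map k A A P"
  by (rule linear_map_cong[OF A linear_map_comp[OF multilinearD[OF multilinear_pure, of "[\<one>\<^bsub>A\<^esub>]" "[]"] h_linear]])
    (simp_all add: operator_of_def)

text \<open>The associativity law at the pure tensor of \<open>1\<close> and \<open>u\<close>: one side is \<open>h(1 \<otimes> h(u))\<close>, the
  other is \<open>h(1 \<diamond> P\<^sub>A(u))\<close>.\<close>
lemma h_sha_P:
  assumes u: "u \<in> carrier \<S>"
  shows "h (sha_cons k A \<one>\<^bsub>A\<^esub> u) = P (h u)"
proof -
  have one: "pure k A [\<one>\<^bsub>A\<^esub>] \<in> carrier \<S>" by (simp add: pure_closed)
  have "h (pure k A [\<one>\<^bsub>A\<^esub>, h u]) = h (nested_P (free_rb k l A) [pure k A [\<one>\<^bsub>A\<^esub>], u])"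
    using h_assoc[of "[pure k A [\<one>\<^bsub>A\<^esub>], u]"] u one by (simp add: h_unit)
  also have "\<dots> = h (sha_cons k A \<one>\<^bsub>A\<^esub> u)"
    using u by (simp add: free_rb_def diamond_one_left linear_map_closed[OF linear_map_sha_P] flip: sha_P_eq)
  finally show ?thesis using h_closed[OF u] by (simp add: operator_of_def)
qed

text \<open>Write \<open>a \<otimes> u\<close> as \<open>a \<diamond> (1 \<otimes> u)\<close> and use that \<open>h\<close> is multiplicative and is the identity
  on \<open>A\<close>.  Iterated, this shows that \<open>h\<close> is the counit of its operator.\<close>
lemma h_pure_Cons:
  assumes "a \<in> carrier A" "as \<noteq> []" "set as \<subseteq> carrier A"
  shows "h (pure k A (a # as)) = a \<otimes>\<^bsub>A\<^esub> P (h (pure k A as))"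
proof -
  have "pure k A (a # as) = diam (pure k A [a]) (pure k A (\<one>\<^bsub>A\<^esub> # as))"
    using assms by (simp add: diamond_pure pure_diamond_single_left)
  then have "h (pure k A (a # as)) = a \<otimes>\<^bsub>A\<^esub> h (pure k A (\<one>\<^bsub>A\<^esub> # as))"
    using assms by (simp add: h_mult pure_closed h_unit)
  also have "h (pure k A (\<one>\<^bsub>A\<^esub> # as)) = P (h (pure k A as))"
    using h_sha_P[OF pure_closed[OF assms(3,2)]] assms by (simp add: sha_cons_pure)
  finally show ?thesis .
qed

text \<open>Apply \<open>h\<close> to the product of \<open>1 \<otimes> x\<close> and \<open>1 \<otimes> y\<close>, which is
  \<open>1 \<otimes> (x \<otimes> y + y \<otimes> x + \<lambda> x y)\<close>.\<close>
theorem operator_of_rota_baxter: "rota_baxter_operator k l A P"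
proof -
  note [simp] = linear_map_closed[OF P_linear]
  have "P x \<otimes>\<^bsub>A\<^esub> P y = P (x \<otimes>\<^bsub>A\<^esub> P y) \<oplus>\<^bsub>A\<^esub> P (y \<otimes>\<^bsub>A\<^esub> P x) \<oplus>\<^bsub>A\<^esub> l \<odot>\<^bsub>A\<^esub> P (x \<otimes>\<^bsub>A\<^esub> y)"
    if x: "x \<in> carrier A" and y: "y \<in> carrier A" for x y
  proof -
    let ?w = "pure k A [x, y] \<oplus>\<^bsub>\<S>\<^esub> pure k A [y, x] \<oplus>\<^bsub>\<S>\<^esub> l \<odot>\<^bsub>\<S>\<^esub> pure k A [x \<otimes>\<^bsub>A\<^esub> y]"
    have "pd [\<one>\<^bsub>A\<^esub>, x] [\<one>\<^bsub>A\<^esub>, y] = sha_cons k A \<one>\<^bsub>A\<^esub> ?w"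
      using x y by (simp add: pure_diamond_rules)
    then have "P x \<otimes>\<^bsub>A\<^esub> P y = h (sha_cons k A \<one>\<^bsub>A\<^esub> ?w)"
      using x y h_mult[of "pure k A [\<one>\<^bsub>A\<^esub>, x]" "pure k A [\<one>\<^bsub>A\<^esub>, y]"]
      by (simp add: pure_closed diamond_pure operator_of_def)
    also have "\<dots> = P (h ?w)" using x y l by (intro h_sha_P) (simp add: pure_closed)
    also have "h ?w = x \<otimes>\<^bsub>A\<^esub> P y \<oplus>\<^bsub>A\<^esub> y \<otimes>\<^bsub>A\<^esub> P x \<oplus>\<^bsub>A\<^esub> l \<odot>\<^bsub>A\<^esub> (x \<otimes>\<^bsub>A\<^esub> y)"
      using x y l by (simp add: linear_mapD[OF h_linear] pure_closed h_pure_Cons h_unit)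
    finally show ?thesis using x y l by (simp add: linear_mapD[OF P_linear])
  qed
  moreover have "P \<in> extensional (carrier A)" by (simp add: operator_of_def)
  ultimately show ?thesis
    using P_linear by (auto simp: rota_baxter_operator_def linear_endo_def linear_map_def PiE_def)
qed

sublocale R: rb_algebra k A l P
  by unfold_locales (rule operator_of_rota_baxter)

lemma h_pure:
  assumes "as \<noteq> []" "set as \<subseteq> carrier A"
  shows "h (pure k A as) = nested_P (A, P) as"
  using assms
proof (induction as)
  case (Cons a as)
  then show ?case by (cases "as = []") (simp_all add: h_pure_Cons h_unit R.nested_Cons)
qed simp

theorem counit_operator_of: "counit_eps k l (A, P) = h"
proof (rule extensionalityI)
  show "counit_eps k l (A, P) \<in> extensional (carrier \<S>)" by (simp add: counit_eps_def)
  show "h \<in> extensional (carrier \<S>)" using alg_hom_ext[OF h_alg_hom] by simp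
  show "counit_eps k l (A, P) u = h u" if "u \<in> carrier \<S>" for u
    by (rule linear_maps_eqI[OF R.eps_linear h_linear _ that]) (simp add: R.eps_pure h_pure)
qed

end

section \<open>The isomorphism of categories\<close>

text \<open>A homomorphism compatible with the counits is compatible with the operators by evaluation at
  \<open>1 \<otimes> x\<close>; conversely one that commutes with the operators commutes with all nested
  expressions.\<close>
lemma T_algebra_hom_counit:
  assumes R: "rb_algebra k R l P" and S: "rb_algebra k S l Q"
  shows "T_algebra_hom k l (R, counit_eps k l (R, P)) (S, counit_eps k l (S, Q)) = rb_hom k (R, P) (S, Q)"
proof -
  interpret R: rb_algebra k R l P by (rule R)
  interpret S: rb_algebra k S l Q by (rule S)
  interpret AR: algebra k R by (rule R.algebra)
  have "(\<forall>u\<in>carrier (Sha k l R). S.eps (T_map k l R S f u) = f (R.eps u)) \<longleftrightarrow> (\<forall>x\<in>carrier R. f (P x) = Q (f x))"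
    (is "?L \<longleftrightarrow> ?R") if f: "f \<in> alg_hom k R S" for f
  proof -
    note lin = alg_hom_linear[OF f]
    note T_pure = R.T_map_pure[OF S.A lin]
    have map: "set (map f as) \<subseteq> carrier S" if "set as \<subseteq> carrier R" for as
      using that linear_map_closed[OF lin] by auto
    show ?thesis
    proof
      assume L: ?L
      show ?R
      proof
        fix x assume x: "x \<in> carrier R"
        have "S.eps (T_map k l R S f (pure k R [\<one>\<^bsub>R\<^esub>, x])) = f (R.eps (pure k R [\<one>\<^bsub>R\<^esub>, x]))"
          using L x by (simp add: R.pure_closed)
        then show "f (P x) = Q (f x)"
          using x linear_map_closed[OF lin x]
          by (simp add: T_pure alg_hom_one[OF f] R.P_from_counit S.P_from_counit)
      qed
    next
      assume Rb: ?R
      have nest: "S.nested (map f as) = f (R.nested as)" if "as \<noteq> []" "set as \<subseteq> carrier R" for as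
        using that
      proof (induction as)
        case (Cons a as)
        show ?case
        proof (cases "as = []")
          case False
          then have "R.nested as \<in> carrier R" using Cons.prems by (intro R.nested_closed) auto
          then show ?thesis
            using False Cons Rb linear_map_closed[OF R.P_linear]
            by (simp add: R.nested_Cons S.nested_Cons alg_hom_mult[OF f])
        qed simp
      qed simp
      show ?L
      proof
        fix u assume "u \<in> carrier (Sha k l R)"
        then have u: "u \<in> carrier (sha_module k R)" by simp
        show "S.eps (T_map k l R S f u) = f (R.eps u)"
          by (rule R.linear_maps_eqI[OF linear_map_comp[OF R.linear_map_T_map[OF S.A lin] S.eps_linear]
                linear_map_comp[OF R.eps_linear lin] _ u])
            (use map in \<open>simp add: T_pure R.eps_pure S.eps_pure nest\<close>)
      qed
    qed
  qed
  then show ?thesis by (auto simp: T_algebra_hom_def rb_hom_def)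
qed

lemma sha_algebraI:
  assumes "algebra k A" "l \<in> carrier k"
  shows "sha_algebra k A l"
  using assms by (intro sha_algebra.intro sha_algebra_axioms.intro tensor_module.intro algebra.module)

lemma RBA_objE:
  assumes "X \<in> Obj (RBA k l)" "l \<in> carrier k"
  obtains R P where "X = (R, P)" "rb_algebra k R l P"
  using assms by (auto simp: RBA_def intro!: rb_algebra.intro rb_algebra_axioms.intro sha_algebraI)

lemma rb_algebra_obj: "rb_algebra k R l P \<Longrightarrow> (R, P) \<in> Obj (RBA k l)"
  by (auto simp: RBA_def rb_algebra.rb rb_algebra_def sha_algebra.algebra)

lemma ALG_T_objE:
  assumes "X \<in> Obj (ALG_T k l)" "l \<in> carrier k"
  obtains A h where "X = (A, h)" "T_algebra k A l h"
proof -
  obtain A h where X: "X = (A, h)" by (cases X)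
  then have T: "is_T_algebra k l (A, h)" using assms(1) by (simp add: ALG_T_def)
  then have "algebra k A" by (simp add: is_T_algebra_def)
  then show thesis using T assms(2) by (intro that[OF X] T_algebra.intro T_algebra_axioms.intro sha_algebraI)
qed

lemma is_category_RBA:
  fixes k :: "'k ring"
  shows "is_category (RBA k l :: (('k, 'a) rb, 'a \<Rightarrow> 'a) cat)"
proof -
  have hom: "f \<in> carrier (fst X) \<rightarrow> carrier (fst Y)" "f \<in> extensional (carrier (fst X))"
    if "f \<in> rb_hom k X Y" for f and X Y :: "('k, 'a) rb"
    using that linear_map_closed[OF alg_hom_linear[of f k "fst X" "fst Y"]] alg_hom_ext[of f k "fst X" "fst Y"]
    by (auto simp: rb_hom_def)
  show ?thesis unfolding is_category_def
  proof (intro conjI ballI)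
    fix X assume "X \<in> Obj (RBA k l :: (('k, 'a) rb, 'a \<Rightarrow> 'a) cat)"
    then obtain R P where X: "X = (R, P)" "algebra k R" "rota_baxter_operator k l R P" by (auto simp: RBA_def)
    interpret R: algebra k R by (rule X(2))
    have "P x \<in> carrier R" if "x \<in> carrier R" for x
      using X(3) that by (auto simp: rota_baxter_operator_def linear_endo_def)
    moreover have "(\<lambda>x\<in>carrier R. x) \<in> alg_hom k R R"
      by (rule alg_homI[OF linear_map_cong[OF R.module linear_map_id]]) simp_all
    ultimately show "Ide (RBA k l) X \<in> Hom (RBA k l) X X"
      by (simp add: RBA_def X(1) rb_hom_def)
  next
    fix X Y Z :: "('k, 'a) rb" and f g assume "f \<in> Hom (RBA k l) X Y" "g \<in> Hom (RBA k l) Y Z"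
      and "X \<in> Obj (RBA k l)"
    then obtain R P where X: "X = (R, P)" "algebra k R" "rota_baxter_operator k l R P"
      and f: "f \<in> rb_hom k X Y" and g: "g \<in> rb_hom k Y Z" by (auto simp: RBA_def)
    interpret R: algebra k R by (rule X(2))
    have P: "P x \<in> carrier R" if "x \<in> carrier R" for x
      using X(3) that by (auto simp: rota_baxter_operator_def linear_endo_def)
    have f': "f \<in> alg_hom k (fst X) (fst Y)" "\<And>x. x \<in> carrier (fst X) \<Longrightarrow> f (snd X x) = snd Y (f x)"
      and g': "g \<in> alg_hom k (fst Y) (fst Z)" "\<And>x. x \<in> carrier (fst Y) \<Longrightarrow> g (snd Y x) = snd Z (g x)"
      using f g by (auto simp: rb_hom_def)
    note lin = alg_hom_linear[OF f'(1)] alg_hom_linear[OF g'(1)]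
    have "linear_map k (fst X) (fst Z) (compose (carrier (fst X)) g f)"
      by (rule linear_map_cong[OF _ linear_map_comp[OF lin]]) (simp_all add: X(1) R.module compose_def)
    then have "compose (carrier (fst X)) g f \<in> alg_hom k (fst X) (fst Z)"
      by (rule alg_homI)
        (simp_all add: X(1) compose_def linear_map_closed[OF lin(1)[unfolded X(1) fst_conv]]
          alg_hom_mult[OF f'(1)[unfolded X(1) fst_conv]] alg_hom_mult[OF g'(1)]
          alg_hom_one[OF f'(1)[unfolded X(1) fst_conv]] alg_hom_one[OF g'(1)])
    then show "Cmp (RBA k l) X Y Z g f \<in> Hom (RBA k l) X Z"
      using f'(2) g'(2) P linear_map_closed[OF lin(1)] by (simp add: RBA_def rb_hom_def compose_def X(1))
  next
    fix X Y :: "('k, 'a) rb" and f assume "f \<in> Hom (RBA k l) X Y"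
    then have "f \<in> rb_hom k X Y" by (simp add: RBA_def)
    note f = hom[OF this]
    show "Cmp (RBA k l) X X Y f (Ide (RBA k l) X) = f" "Cmp (RBA k l) X Y Y (Ide (RBA k l) Y) f = f"
      using f by (auto simp: RBA_def compose_def fun_eq_iff extensional_def)
  next
    fix W X Y Z :: "('k, 'a) rb" and f g h
    assume "f \<in> Hom (RBA k l) W X"
    then have "f \<in> rb_hom k W X" by (simp add: RBA_def)
    note f = hom[OF this]
    show "Cmp (RBA k l) W X Z (Cmp (RBA k l) X Y Z h g) f = Cmp (RBA k l) W Y Z h (Cmp (RBA k l) W X Y g f)"
      using f by (auto simp: RBA_def compose_def fun_eq_iff)
  qed
qed

text \<open>A bijection on objects that leaves hom-sets, identities and composition unchanged transports
  the category axioms along with everything else, so the axioms of the target come for free.\<close>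
lemma is_cat_isomorphism_of_object_bijection:
  fixes C :: "('o, 'm) cat" and D :: "('p, 'm) cat"
  assumes C: "is_category C"
    and K: "\<And>X. X \<in> Obj C \<Longrightarrow> K X \<in> Obj D" and G: "\<And>Y. Y \<in> Obj D \<Longrightarrow> G Y \<in> Obj C"
    and GK: "\<And>X. X \<in> Obj C \<Longrightarrow> G (K X) = X" and KG: "\<And>Y. Y \<in> Obj D \<Longrightarrow> K (G Y) = Y"
    and Hom: "\<And>X Y. X \<in> Obj C \<Longrightarrow> Y \<in> Obj C \<Longrightarrow> Hom D (K X) (K Y) = Hom C X Y"
    and Ide: "\<And>X. X \<in> Obj C \<Longrightarrow> Ide D (K X) = Ide C X"
    and Cmp: "\<And>X Y Z. X \<in> Obj C \<Longrightarrow> Y \<in> Obj C \<Longrightarrow> Z \<in> Obj C \<Longrightarrow> Cmp D (K X) (K Y) (K Z) = Cmp C X Y Z"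
  shows "is_cat_isomorphism C D \<lparr>on_obj = K, on_hom = \<lambda>X Y f. f\<rparr>"
proof -
  have Hom': "Hom D X Y = Hom C (G X) (G Y)" if "X \<in> Obj D" "Y \<in> Obj D" for X Y
    using Hom[of "G X" "G Y"] that by (simp add: G KG)
  have Ide': "Ide D X = Ide C (G X)" if "X \<in> Obj D" for X
    using Ide[of "G X"] that by (simp add: G KG)
  have Cmp': "Cmp D X Y Z = Cmp C (G X) (G Y) (G Z)" if "X \<in> Obj D" "Y \<in> Obj D" "Z \<in> Obj D" for X Y Z
    using Cmp[of "G X" "G Y" "G Z"] that by (simp add: G KG)
  have D: "is_category D"
    using C unfolding is_category_def by (simp add: Hom' Ide' Cmp' G)
  have "is_functor C D \<lparr>on_obj = K, on_hom = \<lambda>X Y f. f\<rparr>"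
    using C D by (simp add: is_functor_def K Hom Ide Cmp)
  moreover have "is_functor D C \<lparr>on_obj = G, on_hom = \<lambda>X Y f. f\<rparr>"
    using C D by (simp add: is_functor_def G Hom' Ide' Cmp')
  ultimately show ?thesis
    unfolding is_cat_isomorphism_def is_left_inverse_functor_def
    by (intro conjI exI[of _ "\<lparr>on_obj = G, on_hom = \<lambda>X Y f. f\<rparr>"]) (simp_all add: GK KG)
qed

theorem theorem2p5:
  fixes k :: "'k ring" and l :: 'k
  assumes "cring k" and "l \<in> carrier k"
  shows "is_cat_isomorphism
    (RBA k l :: (('k, 'a) rb, 'a \<Rightarrow> 'a) cat) (ALG_T k l) (comparison k l)"
  unfolding comparison_def
proof (rule is_cat_isomorphism_of_object_bijection[where G = "\<lambda>X. (fst X, operator_of k (fst X) (snd X))"])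
  note l = \<open>l \<in> carrier k\<close>
  show "is_category (RBA k l :: (('k, 'a) rb, 'a \<Rightarrow> 'a) cat)" by (rule is_category_RBA)
  fix X :: "('k, 'a) rb" assume "X \<in> Obj (RBA k l)"
  then obtain R P where X: "X = (R, P)" and rb: "rb_algebra k R l P" using l by (rule RBA_objE)
  interpret R: rb_algebra k R l P by (rule rb)
  show "(fst X, counit_eps k l X) \<in> Obj (ALG_T k l)"
    using R.counit_T_algebra by (simp add: ALG_T_def X)
  have "operator_of k R (counit_eps k l (R, P)) = P"
    by (rule extensionalityI[OF _ R.P_ext]) (simp_all add: operator_of_def R.P_from_counit)
  then show "(fst (fst X, counit_eps k l X), operator_of k (fst (fst X, counit_eps k l X)) (snd (fst X, counit_eps k l X))) = X"
    by (simp add: X)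
  show "Ide (ALG_T k l) (fst X, counit_eps k l X) = Ide (RBA k l) X"
    by (simp add: ALG_T_def RBA_def)
  fix Y :: "('k, 'a) rb" assume "Y \<in> Obj (RBA k l)"
  then obtain S Q where Y: "Y = (S, Q)" and rb': "rb_algebra k S l Q" using l by (rule RBA_objE)
  show "Hom (ALG_T k l) (fst X, counit_eps k l X) (fst Y, counit_eps k l Y) = Hom (RBA k l) X Y"
    using T_algebra_hom_counit[OF rb rb'] by (simp add: ALG_T_def RBA_def X Y)
next
  fix Y :: "('k, 'a) talg" assume "Y \<in> Obj (ALG_T k l)"
  then obtain A h where Y: "Y = (A, h)" and T: "T_algebra k A l h" using \<open>l \<in> carrier k\<close> by (rule ALG_T_objE)
  interpret T: T_algebra k A l h by (rule T)
  show "(fst Y, operator_of k (fst Y) (snd Y)) \<in> Obj (RBA k l)"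
    using rb_algebra_obj[OF T.R.rb_algebra_axioms] by (simp add: Y)
  show "(fst (fst Y, operator_of k (fst Y) (snd Y)), counit_eps k l (fst Y, operator_of k (fst Y) (snd Y))) = Y"
    by (simp add: Y T.counit_operator_of)
qed (simp add: ALG_T_def RBA_def)

end
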